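(* Let $N > 1$ be an integer and $\alpha_* = 2(N-1)+1$. For each $n \in \mathbb{N}$, consider the set $$W_n = \Big\{ (a_0, a_1, \ldots, a_{n-1}) \in \mathbb{T}^n : a_i \neq a_j \text{ for } i \neq j, \ \sum_{0 \leq k < n} a_k^m = 0 \text{ for } m = 1, 2, \ldots, N^2-2 \Big\}.$$ Then $$\min_{(a_0, a_1, \ldots, a_{n-1}) \in W_n} \Big\| \sum_{0 \leq k < n} \frac{1}{(z-a_k)^N} \Big\|_{\alpha_*} = \| \Psi_n^N \|_{\alpha_*}.$$
   Context: $\mathbb{D}$ is the open unit disc, $\mathbb{T}$ the unit circle. For $\alpha > -1$, $A^2_\alpha$ is the weighted Bergman space of holomorphic functions $f$ on $\mathbb{D}$ with $\|f\|_\alpha^2 = (\alpha+1)\int_{\mathbb{D}} |f(z)|^2 (1-|z|^2)^\alpha \, dA(z) < \infty$, where $dA$ is Lebesgue area measure normalized so that $\mathbb{D}$ has measure $1$. $\Psi_n^N(z) = \sum_{0 \leq k < n} \frac{1}{(z - e^{2\pi i k/n})^N}$ is the function corresponding to $n$ equidistributed points on the unit circle.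
   Formalization: The set W_n is assumed nonempty: for 1 ≤ n ≤ N²−2 it is empty (e.g. N=2, n=1 would force a_0=0), so the minimum over W_n is undefined there; for all other n the claim is as stated. *)

theory Defs
  imports "HOL-Complex_Analysis.Complex_Analysis"
begin

text \<open>The space \<open>A\<^sup>2\<^sub>\<alpha>\<close> and its norm are meant for \<open>\<alpha> > -1\<close>.  The normalised area measure \<open>dA\<close>
  is \<open>lborel\<close> divided by the area \<open>pi\<close> of the disc.  Since \<open>bergman_norm\<close> uses the Bochner
  integral, it is meaningful only for members of \<open>bergman_space\<close>.\<close>

definition bergman_space :: "real \<Rightarrow> (complex \<Rightarrow> complex) set" where
  "bergman_space \<alpha> =
     {f. f holomorphic_on ball 0 1 \<and>
         set_integrable lborel (ball 0 1) (\<lambda>z. (norm (f z))\<^sup>2 * (1 - (norm z)\<^sup>2) powr \<alpha>)}"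

definition bergman_norm :: "real \<Rightarrow> (complex \<Rightarrow> complex) \<Rightarrow> real" where
  "bergman_norm \<alpha> f =
     sqrt ((\<alpha> + 1) * ((LINT z:ball 0 1|lborel. (norm (f z))\<^sup>2 * (1 - (norm z)\<^sup>2) powr \<alpha>) / pi))"

definition pole_sum :: "nat \<Rightarrow> nat \<Rightarrow> (nat \<Rightarrow> complex) \<Rightarrow> complex \<Rightarrow> complex" where
  "pole_sum N n a z = (\<Sum>k<n. 1 / (z - a k) ^ N)"

definition Psi :: "nat \<Rightarrow> nat \<Rightarrow> complex \<Rightarrow> complex" where
  "Psi N n z = (\<Sum>k<n. 1 / (z - exp (2 * of_real pi * \<i> * of_nat k / of_nat n)) ^ N)"

text \<open>An \<open>n\<close>-tuple of points of the unit circle is an extensional function on \<open>{..<n}\<close>.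
  The subtraction in \<open>N\<^sup>2 - 2\<close> does not truncate for \<open>N > 1\<close>.\<close>

definition W :: "nat \<Rightarrow> nat \<Rightarrow> (nat \<Rightarrow> complex) set" where
  "W N n = {a \<in> {..<n} \<rightarrow>\<^sub>E sphere 0 1.
              inj_on a {..<n} \<and> (\<forall>m\<in>{1..N\<^sup>2 - 2}. (\<Sum>k<n. a k ^ m) = 0)}"

definition alpha_star :: "nat \<Rightarrow> real" where
  "alpha_star N = 2 * (real N - 1) + 1"

definition is_minimum :: "real set \<Rightarrow> real \<Rightarrow> bool" where
  "is_minimum S m \<longleftrightarrow> m \<in> S \<and> (\<forall>s\<in>S. m \<le> s)"

end

theory Submission imports Defs begin

text \<open>
  Write \<open>p\<^sub>m = \<Sum>\<^sub>k a\<^sub>k\<^sup>m\<close>. Expanding the poles at the origin gives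
  \<open>\<parallel>\<Sum>\<^sub>k (z - a\<^sub>k)\<^sup>-\<^sup>N\<parallel>\<^sup>2 = C \<Sum>\<^sub>m w\<^sub>m m\<^sup>-\<^sup>2 |p\<^sub>m|\<^sup>2\<close> with
  \<open>w\<^sub>m = m!\<^sup>2 / ((m - N)! (m + N)!)\<close>. Since \<open>p\<^sub>m = 0\<close> for \<open>0 < m < N\<^sup>2 - 1\<close>, the weight may be replaced
  there by a linear one, and it becomes an increasing bounded concave function of \<open>m\<close> that vanishes
  at \<open>0\<close>, hence a superposition with nonnegative coefficients of the functions \<open>min m s\<close>. For each of
  these, \<open>\<Sum>\<^sub>m min m s m\<^sup>-\<^sup>2 |p\<^sub>m|\<^sup>2\<close> is the energy of the points \<open>a\<^sub>k\<close> for the kernel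
  \<open>\<Sum>\<^sub>m min m s m\<^sup>-\<^sup>2 cos (m t)\<close>, whose second derivative on \<open>(0, 2 pi)\<close> is half a Fejer sum and thus
  nonnegative. By Jensen's inequality, applied to the gaps between points a fixed number of places
  apart, equidistributed points minimise the energy of a convex kernel.
\<close>

subsection \<open>Rotation invariance and radial integrals on the disc\<close>

text \<open>Both measures give a box the product of its side lengths, and this characterises
  Lebesgue measure. The identification opens integrals over the complex plane to Fubini's
  theorem.\<close>

lemma lborel_complex_eq:
  "distr (lborel \<Otimes>\<^sub>M lborel) borel (\<lambda>(x, y). Complex x y) = lborel"
proof -
  have meas: "(\<lambda>(x, y). Complex x y) \<in> borel_measurable (lborel \<Otimes>\<^sub>M lborel)"
    unfolding Complex_eq case_prod_beta by measurable
  show ?thesis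
  proof (rule lborel_eqI[symmetric])
    fix l u :: complex
    assume le: "\<And>b. b \<in> Basis \<Longrightarrow> l \<bullet> b \<le> u \<bullet> b"
    have le': "Re l \<le> Re u" "Im l \<le> Im u"
      using le[of 1] le[of \<i>] by (auto simp: Basis_complex_def)
    have vim: "(\<lambda>(x, y). Complex x y) -` box l u \<inter> space (lborel \<Otimes>\<^sub>M lborel) =
        {Re l<..<Re u} \<times> {Im l<..<Im u}"
      by (auto simp: box_def Basis_complex_def space_pair_measure)
    have "emeasure (distr (lborel \<Otimes>\<^sub>M lborel) borel (\<lambda>(x, y). Complex x y)) (box l u) =
        emeasure (lborel \<Otimes>\<^sub>M lborel) ({Re l<..<Re u} \<times> {Im l<..<Im u})"
      by (subst emeasure_distr[OF meas]) (simp_all only: vim, auto)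
    also have "\<dots> = ennreal (Re u - Re l) * ennreal (Im u - Im l)"
      using le' by (subst lborel.emeasure_pair_measure_Times) auto
    also have "\<dots> = ennreal ((Re u - Re l) * (Im u - Im l))"
      using le' by (simp add: ennreal_mult)
    finally show "emeasure (distr (lborel \<Otimes>\<^sub>M lborel) borel (\<lambda>(x, y). Complex x y)) (box l u) =
        (\<Prod>b\<in>Basis. (u - l) \<bullet> b)"
      by (simp add: Basis_complex_def)
  qed simp
qed

lemma nn_integral_complex_fst:
  assumes [measurable]: "f \<in> borel_measurable borel"
  shows "(\<integral>\<^sup>+z. f z \<partial>lborel) = (\<integral>\<^sup>+x. \<integral>\<^sup>+y. f (Complex x y) \<partial>lborel \<partial>lborel)"
proof -
  have meas[measurable]: "(\<lambda>(x, y). Complex x y) \<in> borel_measurable (lborel \<Otimes>\<^sub>M lborel)"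
    unfolding Complex_eq case_prod_beta by measurable
  have "(\<integral>\<^sup>+z. f z \<partial>lborel) = (\<integral>\<^sup>+p. f (case p of (x, y) \<Rightarrow> Complex x y) \<partial>(lborel \<Otimes>\<^sub>M lborel))"
    by (subst lborel_complex_eq[symmetric]) (simp add: nn_integral_distr)
  also have "\<dots> = (\<integral>\<^sup>+x. \<integral>\<^sup>+y. f (Complex x y) \<partial>lborel \<partial>lborel)"
    by (subst lborel.nn_integral_fst[symmetric]) auto
  finally show ?thesis .
qed

lemma nn_integral_complex_snd:
  assumes [measurable]: "f \<in> borel_measurable borel"
  shows "(\<integral>\<^sup>+z. f z \<partial>lborel) = (\<integral>\<^sup>+y. \<integral>\<^sup>+x. f (Complex x y) \<partial>lborel \<partial>lborel)"
proof -
  have meas[measurable]: "(\<lambda>(x, y). Complex x y) \<in> borel_measurable (lborel \<Otimes>\<^sub>M lborel)"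
    unfolding Complex_eq case_prod_beta by measurable
  have [measurable]: "(\<lambda>(x, y). f (Complex x y)) \<in> borel_measurable (lborel \<Otimes>\<^sub>M lborel)"
    unfolding Complex_eq case_prod_beta by measurable
  show ?thesis
    unfolding nn_integral_complex_fst[OF assms]
    by (rule lborel_pair.Fubini'[symmetric]) measurable
qed

lemma nn_integral_shift_real:
  fixes f :: "real \<Rightarrow> ennreal"
  assumes [measurable]: "f \<in> borel_measurable borel"
  shows "(\<integral>\<^sup>+x. f (x + c) \<partial>lborel) = (\<integral>\<^sup>+x. f x \<partial>lborel)"
  by (subst (2) lborel_distr_plus[of c, symmetric]) (simp add: nn_integral_distr add.commute)

text \<open>For a fixed imaginary part the shear translates the real line, so integrating over the
  real part first leaves the inner integral unchanged.\<close>

lemma nn_integral_shear_Re: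
  assumes [measurable]: "f \<in> borel_measurable borel"
  shows "(\<integral>\<^sup>+z. f (Complex (Re z + t * Im z) (Im z)) \<partial>lborel) = (\<integral>\<^sup>+z. f z \<partial>lborel)"
proof -
  have [measurable]: "(\<lambda>x. f (Complex x y)) \<in> borel_measurable borel" for y
    unfolding Complex_eq by measurable
  have m: "(\<lambda>z. f (Complex (Re z + t * Im z) (Im z))) \<in> borel_measurable borel"
    unfolding Complex_eq by measurable
  show ?thesis
    by (subst nn_integral_complex_snd[OF m], subst nn_integral_complex_snd[OF assms])
       (simp add: nn_integral_shift_real[where f = "\<lambda>x. f (Complex x _)"])
qed

lemma nn_integral_shear_Im:
  assumes [measurable]: "f \<in> borel_measurable borel"
  shows "(\<integral>\<^sup>+z. f (Complex (Re z) (Im z + t * Re z)) \<partial>lborel) = (\<integral>\<^sup>+z. f z \<partial>lborel)"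
proof -
  have [measurable]: "(\<lambda>y. f (Complex x y)) \<in> borel_measurable borel" for x
    unfolding Complex_eq by measurable
  have m: "(\<lambda>z. f (Complex (Re z) (Im z + t * Re z))) \<in> borel_measurable borel"
    unfolding Complex_eq by measurable
  show ?thesis
    by (subst nn_integral_complex_fst[OF m], subst nn_integral_complex_fst[OF assms])
       (simp add: nn_integral_shift_real[where f = "\<lambda>y. f (Complex _ y)"])
qed

text \<open>A rotation other than \<open>-1\<close> is a product of three shears.\<close>

lemma nn_integral_rotate:
  fixes w :: complex
  assumes [measurable]: "f \<in> borel_measurable borel" and w: "cmod w = 1"
  shows "(\<integral>\<^sup>+z. f (w * z) \<partial>lborel) = (\<integral>\<^sup>+z. f z \<partial>lborel)"
proof -
  have main: "(\<integral>\<^sup>+z. f (w * z) \<partial>lborel) = (\<integral>\<^sup>+z. f z \<partial>lborel)"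
    if [measurable]: "f \<in> borel_measurable borel" and w: "cmod w = 1" "Re w \<noteq> -1" for f w
  proof -
    \<comment> \<open>Minus the tangent of half the angle of \<open>w\<close>, the coefficient of
      the two outer shears; it is finite exactly for \<open>w\<close> other than
      \<open>-1\<close>.\<close>
    define t where "t = - Im w / (1 + Re w)"
    define S where "S = (\<lambda>z. Complex (Re z + t * Im z) (Im z))"
    define T where "T = (\<lambda>z. Complex (Re z) (Im z + Im w * Re z))"
    have [measurable]: "S \<in> borel_measurable borel" "T \<in> borel_measurable borel"
      unfolding S_def T_def Complex_eq by measurable
    have ne: "1 + Re w \<noteq> 0" using w by auto
    have n: "(Re w)\<^sup>2 + (Im w)\<^sup>2 = 1"
      using w cmod_power2[of w] by simp
    have a: "1 + Im w * t = Re w"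
      using n ne by (simp add: t_def field_simps power2_eq_square)
    have b: "t * (1 + Re w) = - Im w"
      using ne by (simp add: t_def)
    have shear: "(\<integral>\<^sup>+z. g (S z) \<partial>lborel) = (\<integral>\<^sup>+z. g z \<partial>lborel)"
      if "g \<in> borel_measurable borel" for g
      using nn_integral_shear_Re[OF that, of t] by (simp only: S_def)
    have "w * z = S (T (S z))" for z
    proof (rule complex_eqI)
      have "Im (S (T (S z))) = Im w * Re z + (1 + Im w * t) * Im z"
        by (simp add: S_def T_def algebra_simps)
      then show im: "Im (w * z) = Im (S (T (S z)))"
        unfolding a by simp
      have "Re (S (T (S z))) = (1 + Im w * t) * Re z + t * (1 + (1 + Im w * t)) * Im z"
        by (simp add: S_def T_def algebra_simps)
      then show "Re (w * z) = Re (S (T (S z)))"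
        unfolding a b by simp
    qed
    then have "(\<integral>\<^sup>+z. f (w * z) \<partial>lborel) = (\<integral>\<^sup>+z. f (S (T (S z))) \<partial>lborel)"
      by simp
    also have "\<dots> = (\<integral>\<^sup>+z. f (S (T z)) \<partial>lborel)"
      by (rule shear) simp
    also have "\<dots> = (\<integral>\<^sup>+z. f (S z) \<partial>lborel)"
      using nn_integral_shear_Im[of "\<lambda>z. f (S z)" "Im w"] unfolding T_def by simp
    also have "\<dots> = (\<integral>\<^sup>+z. f z \<partial>lborel)"
      by (rule shear) simp
    finally show ?thesis .
  qed
  show ?thesis
  proof (cases "Re w = -1")
    case False
    with main[OF assms] show ?thesis by blast
  next
    case True
    \<comment> \<open>Here \<open>w = -1\<close>, which is reached by two quarter turns.\<close>
    with w have "w = \<i> * \<i>"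
      using cmod_power2[of w] by (simp add: complex_eq_iff)
    then have "(\<integral>\<^sup>+z. f (w * z) \<partial>lborel) = (\<integral>\<^sup>+z. f (\<i> * (\<i> * z)) \<partial>lborel)"
      by (simp add: mult.assoc)
    also have "\<dots> = (\<integral>\<^sup>+z. f (\<i> * z) \<partial>lborel)"
      by (rule main[of "\<lambda>z. f (\<i> * z)" \<i>]) auto
    also have "\<dots> = (\<integral>\<^sup>+z. f z \<partial>lborel)"
      by (rule main) auto
    finally show ?thesis .
  qed
qed

text \<open>Lebesgue measure is rotation invariant, so it is enough that the density is. This
  supplies the hypothesis \<open>inv\<close> of the Parseval lemmas.\<close>

lemma distr_rotate_density:
  fixes w :: complex
  assumes [measurable]: "g \<in> borel_measurable borel" and w: "cmod w = 1"
    and rad: "\<And>z. g (w * z) = g z"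
  shows "distr (density lborel g) borel ((*) w) = density lborel g"
proof (rule measure_eqI)
  fix A assume "A \<in> sets (distr (density lborel g) borel ((*) w))"
  then have [measurable]: "A \<in> sets borel" by simp
  have "emeasure (distr (density lborel g) borel ((*) w)) A =
      (\<integral>\<^sup>+z. indicator A z \<partial>distr (density lborel g) borel ((*) w))"
    by simp
  also have "\<dots> = (\<integral>\<^sup>+z. g z * indicator A (w * z) \<partial>lborel)"
    by (simp add: nn_integral_distr nn_integral_density del: nn_integral_indicator)
  also have "\<dots> = (\<integral>\<^sup>+z. (\<lambda>z. g z * indicator A z) (w * z) \<partial>lborel)"
    by (simp add: rad)
  also have "\<dots> = (\<integral>\<^sup>+z. g z * indicator A z \<partial>lborel)"
    by (rule nn_integral_rotate) (auto simp: w)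
  also have "\<dots> = emeasure (density lborel g) A"
    by (simp add: emeasure_density)
  finally show "emeasure (distr (density lborel g) borel ((*) w)) A = emeasure (density lborel g) A" .
qed simp

text \<open>The area of a disc is proportional to its squared radius, so the squared modulus carries
  area on the unit disc to \<open>pi\<close> times Lebesgue measure on \<open>{0..<1}\<close>.
  Agreement of the two measures on the half-lines \<open>{x<..}\<close>, where they are finite, is
  enough.\<close>

lemma nn_integral_radial:
  fixes g :: "real \<Rightarrow> ennreal"
  assumes [measurable]: "g \<in> borel_measurable borel"
  shows "(\<integral>\<^sup>+z\<in>ball 0 1. g ((cmod z)\<^sup>2) \<partial>lborel) = ennreal pi * (\<integral>\<^sup>+t\<in>{0..<1}. g t \<partial>lborel)"
proof -
  have [measurable]: "ball (0::complex) 1 \<in> sets borel"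
    by simp
  define M where "M = distr (density lborel (indicator (ball (0::complex) 1))) borel (\<lambda>z. (cmod z)\<^sup>2)"
  define N where "N = density lborel (\<lambda>t::real. ennreal pi * indicator {0..<1} t)"
  have vol: "emeasure lborel (ball (0::complex) r) = ennreal (pi * r\<^sup>2)"
      "emeasure lborel (cball (0::complex) r) = ennreal (pi * r\<^sup>2)" if "r \<ge> 0" for r
    using that emeasure_ball[of r "0::complex"] emeasure_cball[of r "0::complex"]
    by (simp_all add: unit_ball_vol_2)
  have M: "emeasure M {x<..} = emeasure lborel (ball (0::complex) 1 \<inter> {z. x < (cmod z)\<^sup>2})" for x
  proof -
    have "emeasure (distr (density lborel (indicator (ball (0::complex) 1))) borel (\<lambda>z. (cmod z)\<^sup>2)) {x<..} =
        (\<integral>\<^sup>+t. indicator {x<..} t \<partial>distr (density lborel (indicator (ball (0::complex) 1))) borel (\<lambda>z. (cmod z)\<^sup>2))"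
      by simp
    also have "\<dots> = (\<integral>\<^sup>+z. indicator (ball (0::complex) 1 \<inter> {z. x < (cmod z)\<^sup>2}) z \<partial>lborel)"
      by (subst nn_integral_distr, simp, simp, subst nn_integral_density)
         (auto simp del: nn_integral_indicator intro!: nn_integral_cong split: split_indicator)
    also have "\<dots> = emeasure lborel (ball (0::complex) 1 \<inter> {z. x < (cmod z)\<^sup>2})"
      by simp
    finally show ?thesis
      unfolding M_def .
  qed
  have N: "emeasure N {x<..} = ennreal pi * emeasure lborel ({0..<1} \<inter> {x<..})" for x
    unfolding N_def
    by (subst emeasure_density)
       (auto simp flip: nn_integral_indicator nn_integral_cmult
          intro!: nn_integral_cong split: split_indicator)
  have MN: "emeasure M {x<..} = emeasure N {x<..}" for x
  proof -
    consider "x < 0" | "x \<ge> 1" | "0 \<le> x" "x < 1" by linarith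
    then show ?thesis
    proof cases
      case 1
      have "ball (0::complex) 1 \<inter> {z. x < (cmod z)\<^sup>2} = ball 0 1"
        using 1 by (auto intro: less_le_trans)
      moreover have "{0..<1} \<inter> {x<..} = {0..<1}" using 1 by auto
      ultimately show ?thesis unfolding M N using vol[of 1] by simp
    next
      case 2
      have "ball (0::complex) 1 \<inter> {z. x < (cmod z)\<^sup>2} = {}"
      proof -
        have "(cmod z)\<^sup>2 \<le> 1" if "cmod z < 1" for z :: complex
          using that by (simp add: power_le_one)
        then show ?thesis using 2 by fastforce
      qed
      moreover have "{0..<1} \<inter> {x<..} = {}" using 2 by auto
      ultimately show ?thesis unfolding M N by simp
    next
      case 3
      have iff: "x < (cmod z)\<^sup>2 \<longleftrightarrow> sqrt x < cmod z" for z :: complex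
        using 3 real_less_lsqrt[of x "cmod z"] real_sqrt_less_iff[of x "(cmod z)\<^sup>2"] by simp
      have "ball (0::complex) 1 \<inter> {z. x < (cmod z)\<^sup>2} = ball 0 1 - cball 0 (sqrt x)"
        unfolding iff by auto
      moreover have "{0..<1} \<inter> {x<..} = {x<..<1}" using 3 by auto
      moreover have "emeasure lborel (ball (0::complex) 1 - cball 0 (sqrt x)) = ennreal (pi * (1 - x))"
        using 3 vol[of 1] vol[of "sqrt x"]
          order.strict_trans1[of _ "sqrt x" 1]
        by (subst emeasure_Diff) (auto simp: ennreal_minus right_diff_distrib)
      ultimately show ?thesis unfolding M N using 3 by (simp add: ennreal_mult)
    qed
  qed
  have "M = N"
  proof (rule measure_eqI_lessThan)
    fix x
    have "emeasure N {x<..} \<le> ennreal pi * emeasure lborel {0..<1::real}"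
      unfolding N by (intro mult_left_mono emeasure_mono) auto
    then show "emeasure M {x<..} < \<infinity>"
      unfolding MN by (simp add: order_le_less_trans ennreal_mult_less_top)
  qed (simp_all add: M_def N_def MN[unfolded M_def N_def])
  have "(\<integral>\<^sup>+z\<in>ball 0 1. g ((cmod z)\<^sup>2) \<partial>lborel) = (\<integral>\<^sup>+t. g t \<partial>M)"
    unfolding M_def by (simp add: nn_integral_distr nn_integral_density mult.commute)
  also have "\<dots> = (\<integral>\<^sup>+t. ennreal pi * (g t * indicator {0..<1} t) \<partial>lborel)"
    unfolding \<open>M = N\<close> N_def by (simp add: nn_integral_density ac_simps)
  also have "\<dots> = ennreal pi * (\<integral>\<^sup>+t\<in>{0..<1}. g t \<partial>lborel)"
    by (simp add: nn_integral_cmult)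
  finally show ?thesis .
qed

subsection \<open>Parseval's identity on the disc\<close>

text \<open>A suitable rotation turns the integrand into its negative while \<open>M\<close> is
  unchanged, so the integral equals its own negative.\<close>

lemma integral_monomials_orthogonal:
  fixes M :: "complex measure"
  assumes inv: "\<And>w. cmod w = 1 \<Longrightarrow> distr M borel ((*) w) = M"
    and sets [measurable_cong]: "sets M = sets borel" and "j \<noteq> k"
  shows "(LINT z|M. z ^ j * cnj (z ^ k)) = 0"
proof -
  \<comment> \<open>The angle is chosen so that \<open>w ^ j * cnj (w ^ k) = cis (- pi)\<close>; the
    difference is taken in the reals because \<open>k < j\<close> may occur.\<close>
  define w where "w = cis (pi / (real k - real j))"
  have meas: "(\<lambda>z. z ^ j * cnj (z ^ k)) \<in> borel_measurable borel"
    by (intro borel_measurable_continuous_onI continuous_intros)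
  have "w ^ j * cnj (w ^ k) = cis (real j * (pi / (real k - real j)) - real k * (pi / (real k - real j)))"
    by (simp add: w_def Complex.DeMoivre cis_cnj cis_mult)
  also have "real j * (pi / (real k - real j)) - real k * (pi / (real k - real j)) = - pi"
  proof -
    have *: "real j * a - real k * a = - ((real k - real j) * a)" for a
      by (simp add: algebra_simps)
    then show ?thesis
      unfolding * using \<open>j \<noteq> k\<close> by simp
  qed
  finally have w: "w ^ j * cnj (w ^ k) = -1"
    by (simp flip: cis_cnj)
  have "(LINT z|M. z ^ j * cnj (z ^ k)) = (LINT z|distr M borel ((*) w). z ^ j * cnj (z ^ k))"
    by (simp add: inv w_def)
  also have "\<dots> = (LINT z|M. (w * z) ^ j * cnj ((w * z) ^ k))"
    by (rule integral_distr[OF _ meas]) simp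
  also have "\<dots> = (LINT z|M. w ^ j * cnj (w ^ k) * (z ^ j * cnj (z ^ k)))"
    by (simp add: power_mult_distrib mult_ac)
  also have "\<dots> = - (LINT z|M. z ^ j * cnj (z ^ k))"
    unfolding w by simp
  finally show ?thesis
    by (simp add: eq_neg_iff_add_eq_0 flip: mult_2)
qed

text \<open>Expanding the square gives a double sum of monomial integrals, each integrable since
  \<open>M\<close> is finite with bounded support. Orthogonality leaves the diagonal.\<close>

lemma parseval_polynomial:
  fixes M :: "complex measure" and c :: "nat \<Rightarrow> complex"
  assumes fin: "finite_measure M"
    and inv: "\<And>w. cmod w = 1 \<Longrightarrow> distr M borel ((*) w) = M"
    and sets [measurable_cong]: "sets M = sets borel" and supp: "AE z in M. cmod z \<le> R" and "0 \<le> R"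
  shows "(LINT z|M. (cmod (\<Sum>j<n. c j * z ^ j))\<^sup>2) = (\<Sum>j<n. (cmod (c j))\<^sup>2 * (LINT z|M. cmod z ^ (2 * j)))"
proof -
  interpret finite_measure M by fact
  have int: "integrable M (\<lambda>z. z ^ j * cnj (z ^ k))" for j k
  proof (rule integrable_const_bound)
    show "AE z in M. cmod (z ^ j * cnj (z ^ k)) \<le> R ^ j * R ^ k"
      using supp by eventually_elim
        (simp add: norm_mult norm_power, intro mult_mono power_mono zero_le_power norm_ge_zero \<open>0 \<le> R\<close>)
    show "(\<lambda>z. z ^ j * cnj (z ^ k)) \<in> borel_measurable M"
      unfolding measurable_cong_sets[OF sets refl]
      by (intro borel_measurable_continuous_onI continuous_intros)
  qed
  have sq: "complex_of_real ((cmod (\<Sum>j<n. c j * z ^ j))\<^sup>2) =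
      (\<Sum>j<n. \<Sum>k<n. (c j * cnj (c k)) * (z ^ j * cnj (z ^ k)))" for z
    by (simp add: complex_norm_square sum_product mult_ac del: of_real_power)
  have "complex_of_real (LINT z|M. (cmod (\<Sum>j<n. c j * z ^ j))\<^sup>2) =
      (LINT z|M. (\<Sum>j<n. \<Sum>k<n. (c j * cnj (c k)) * (z ^ j * cnj (z ^ k))))"
    by (subst integral_complex_of_real[symmetric]) (simp only: sq)
  also have "\<dots> = (\<Sum>j<n. \<Sum>k<n. (c j * cnj (c k)) * (LINT z|M. z ^ j * cnj (z ^ k)))"
    using int by (simp add: Bochner_Integration.integral_sum)
  also have "\<dots> = (\<Sum>j<n. (c j * cnj (c j)) * (LINT z|M. z ^ j * cnj (z ^ j)))"
  proof (intro sum.cong refl)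
    fix j assume "j \<in> {..<n}"
    have "(\<Sum>k<n. (c j * cnj (c k)) * (LINT z|M. z ^ j * cnj (z ^ k))) =
        (\<Sum>k\<in>{j}. (c j * cnj (c k)) * (LINT z|M. z ^ j * cnj (z ^ k)))"
      using \<open>j \<in> {..<n}\<close> integral_monomials_orthogonal[OF inv sets, of j]
      by (intro sum.mono_neutral_right) auto
    then show "(\<Sum>k<n. (c j * cnj (c k)) * (LINT z|M. z ^ j * cnj (z ^ k))) =
        (c j * cnj (c j)) * (LINT z|M. z ^ j * cnj (z ^ j))"
      by simp
  qed
  also have "\<dots> = (\<Sum>j<n. complex_of_real ((cmod (c j))\<^sup>2 * (LINT z|M. cmod z ^ (2 * j))))"
  proof (intro sum.cong refl)
    fix j
    have "z ^ j * cnj (z ^ j) = complex_of_real (cmod z ^ (2 * j))" for z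
      by (subst complex_norm_square[symmetric]) (simp add: norm_power power_mult mult.commute flip: power_mult)
    then show "(c j * cnj (c j)) * (LINT z|M. z ^ j * cnj (z ^ j)) =
        complex_of_real ((cmod (c j))\<^sup>2 * (LINT z|M. cmod z ^ (2 * j)))"
      by (simp only: integral_complex_of_real of_real_mult complex_norm_square)
  qed
  also have "\<dots> = complex_of_real (\<Sum>j<n. (cmod (c j))\<^sup>2 * (LINT z|M. cmod z ^ (2 * j)))"
    by simp
  finally show ?thesis
    by (simp only: of_real_eq_iff)
qed

text \<open>Dominated convergence from the partial sums, which are bounded on the support by the sum
  of \<open>cmod (c j) * R ^ j\<close>. The integrand is the series rather than \<open>f\<close>
  because the series is Borel measurable on the whole plane.\<close>

lemma parseval_power_series:
  fixes M :: "complex measure" and c :: "nat \<Rightarrow> complex"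
  assumes fin: "finite_measure M"
    and inv: "\<And>w. cmod w = 1 \<Longrightarrow> distr M borel ((*) w) = M"
    and sets [measurable_cong]: "sets M = sets borel"
    and supp: "AE z in M. cmod z \<le> R" and R: "0 \<le> R" "summable (\<lambda>j. cmod (c j) * R ^ j)"
    and f: "AE z in M. (\<lambda>j. c j * z ^ j) sums f z"
  shows "integrable M (\<lambda>z. (cmod (\<Sum>j. c j * z ^ j))\<^sup>2)"
    and "(\<lambda>j. (cmod (c j))\<^sup>2 * (LINT z|M. cmod z ^ (2 * j))) sums (LINT z|M. (cmod (\<Sum>j. c j * z ^ j))\<^sup>2)"
proof -
  interpret finite_measure M by fact
  define B where "B = (\<Sum>j. cmod (c j) * R ^ j)"
  have [measurable]: "(\<lambda>z. \<Sum>j<n. c j * z ^ j) \<in> borel_measurable borel" for n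
    by (intro borel_measurable_continuous_onI continuous_intros)
  have [measurable]: "(\<lambda>z. \<Sum>j. c j * z ^ j) \<in> borel_measurable borel"
    by measurable
  have lim: "AE z in M. (\<lambda>n. (cmod (\<Sum>j<n. c j * z ^ j))\<^sup>2) \<longlonglongrightarrow> (cmod (\<Sum>j. c j * z ^ j))\<^sup>2"
    using f by eventually_elim (intro tendsto_intros, metis sums_def sums_unique)
  have bound: "AE z in M. norm ((cmod (\<Sum>j<n. c j * z ^ j))\<^sup>2) \<le> B\<^sup>2" for n
    using supp
  proof eventually_elim
    fix z assume z: "cmod z \<le> R"
    have "cmod (\<Sum>j<n. c j * z ^ j) \<le> (\<Sum>j<n. cmod (c j) * R ^ j)"
      using z by (intro order_trans[OF norm_sum] sum_mono)
        (auto simp: norm_mult norm_power intro!: mult_left_mono power_mono)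
    also have "\<dots> \<le> B"
      unfolding B_def using R by (intro sum_le_suminf) auto
    finally show "norm ((cmod (\<Sum>j<n. c j * z ^ j))\<^sup>2) \<le> B\<^sup>2"
      by (simp add: power_mono)
  qed
  show "integrable M (\<lambda>z. (cmod (\<Sum>j. c j * z ^ j))\<^sup>2)"
    by (rule integrable_dominated_convergence[OF _ _ _ lim bound]) auto
  have "(\<lambda>n. LINT z|M. (cmod (\<Sum>j<n. c j * z ^ j))\<^sup>2) \<longlonglongrightarrow> (LINT z|M. (cmod (\<Sum>j. c j * z ^ j))\<^sup>2)"
    by (rule integral_dominated_convergence[OF _ _ _ lim bound]) auto
  then show "(\<lambda>j. (cmod (c j))\<^sup>2 * (LINT z|M. cmod z ^ (2 * j))) sums (LINT z|M. (cmod (\<Sum>j. c j * z ^ j))\<^sup>2)"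
    unfolding sums_def by (simp only: parseval_polynomial[OF fin inv sets supp R(1)])
qed

text \<open>Parseval on the discs of radius \<open>R < 1\<close>, followed by monotone convergence
  as \<open>R\<close> tends to \<open>1\<close>. Both sides are extended nonnegative, so they may be
  infinite, and finiteness can be decided afterwards from the right-hand side.\<close>

lemma nn_integral_power_series_radial:
  fixes c :: "nat \<Rightarrow> complex" and h :: "real \<Rightarrow> real"
  assumes [measurable]: "h \<in> borel_measurable borel"
    and h: "\<And>t. 0 \<le> t \<Longrightarrow> t < 1 \<Longrightarrow> 0 \<le> h t \<and> h t \<le> 1"
    and f: "\<And>z. cmod z < 1 \<Longrightarrow> (\<lambda>j. c j * z ^ j) sums f z"
  shows "(\<integral>\<^sup>+z\<in>ball 0 1. ennreal ((cmod (f z))\<^sup>2 * h (cmod z)) \<partial>lborel) =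
    (\<Sum>j. ennreal ((cmod (c j))\<^sup>2) * (\<integral>\<^sup>+z\<in>ball 0 1. ennreal (cmod z ^ (2 * j) * h (cmod z)) \<partial>lborel))"
proof -
  \<comment> \<open>A Borel function on the whole plane that agrees with \<open>f\<close> inside the
    unit disc.\<close>
  define S where "S = (\<lambda>z. \<Sum>j. c j * z ^ j)"
  have [measurable]: "S \<in> borel_measurable borel"
    unfolding S_def by measurable
  have S_eq: "(\<Sum>j. c j * z ^ j) = S z" for z
    by (simp add: S_def)
  have S: "S z = f z" if "cmod z < 1" for z
    using f[OF that] by (simp add: S_def sums_iff)
  \<comment> \<open>The coefficient series is moved under the integral, so that both sides become
    integrals against the same cut-off weight \<open>g R\<close>.\<close>
  define G where "G = (\<lambda>z. \<Sum>j. ennreal ((cmod (c j))\<^sup>2 * cmod z ^ (2 * j)))"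
  have [measurable]: "G \<in> borel_measurable borel"
    unfolding G_def by measurable
  define g where "g = (\<lambda>R z. ennreal (h (cmod z)) * indicator (ball 0 R) z)"
  have [measurable]: "ball (0::complex) R \<in> sets borel" for R
    by simp
  have [measurable]: "g R \<in> borel_measurable borel" for R
    unfolding g_def by measurable
  have eq: "(\<integral>\<^sup>+z. ennreal ((cmod (S z))\<^sup>2) * g R z \<partial>lborel) = (\<integral>\<^sup>+z. G z * g R z \<partial>lborel)"
    if R: "0 \<le> R" "R < 1" for R
  proof -
    define M where "M = density lborel (g R)"
    have sets [measurable_cong]: "sets M = sets borel"
      by (simp add: M_def)
    have "emeasure M (space M) \<le> (\<integral>\<^sup>+z. indicator (ball (0::complex) R) z \<partial>lborel)"
      using h R unfolding M_def g_def
      by (subst emeasure_density)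
         (auto intro!: nn_integral_mono simp del: nn_integral_indicator split: split_indicator)
    also have "\<dots> < \<infinity>"
      by (simp add: emeasure_ball R)
    finally interpret finite_measure M
      by (intro finite_measureI) auto
    have inv: "distr M borel ((*) w) = M" if "cmod w = 1" for w
      unfolding M_def using that
      by (intro distr_rotate_density) (auto simp: g_def norm_mult split: split_indicator)
    have AE: "AE z in M. cmod z \<le> R"
      unfolding M_def by (subst AE_density) (auto simp: g_def split: split_indicator)
    have sumR: "summable (\<lambda>j. cmod (c j) * R ^ j)"
    proof -
      \<comment> \<open>Convergence at the larger radius \<open>q\<close> gives absolute convergence
        at \<open>R\<close>.\<close>
      obtain q where q: "R < q" "q < 1"
        using dense R by blast
      have "summable (\<lambda>j. c j * of_real q ^ j)"
        using f[of "of_real q"] q R by (auto simp: sums_iff)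
      from powser_insidea[OF this, of "of_real R"] show ?thesis
        using q R by (simp add: norm_mult norm_power)
    qed
    have AEs: "AE z in M. (\<lambda>j. c j * z ^ j) sums f z"
      using AE by eventually_elim (use f R in auto)
    note par = parseval_power_series[OF finite_measure_axioms inv sets AE R(1) sumR AEs, unfolded S_eq]
    have int: "integrable M (\<lambda>z. cmod z ^ (2 * j))" for j
      by (rule integrable_const_bound[where B = "R ^ (2 * j)"])
         (use AE in \<open>eventually_elim, auto intro!: power_mono\<close>, measurable)
    have "(\<integral>\<^sup>+z. ennreal ((cmod (S z))\<^sup>2) * g R z \<partial>lborel) = (\<integral>\<^sup>+z. ennreal ((cmod (S z))\<^sup>2) \<partial>M)"
      unfolding M_def by (subst nn_integral_density) (auto simp: mult.commute)
    also have "\<dots> = ennreal (LINT z|M. (cmod (S z))\<^sup>2)"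
      by (rule nn_integral_eq_integral[OF par(1)]) auto
    also have "\<dots> = (\<Sum>j. ennreal ((cmod (c j))\<^sup>2 * (LINT z|M. cmod z ^ (2 * j))))"
      by (rule suminf_ennreal_eq[symmetric, OF _ par(2)]) auto
    also have "\<dots> = (\<Sum>j. \<integral>\<^sup>+z. ennreal ((cmod (c j))\<^sup>2 * cmod z ^ (2 * j)) \<partial>M)"
      by (simp add: nn_integral_eq_integral int)
    also have "\<dots> = (\<integral>\<^sup>+z. G z \<partial>M)"
      unfolding G_def by (rule nn_integral_suminf[symmetric]) measurable
    also have "\<dots> = (\<integral>\<^sup>+z. G z * g R z \<partial>lborel)"
      unfolding M_def by (subst nn_integral_density) (auto simp: mult.commute)
    finally show ?thesis .
  qed
  define R :: "nat \<Rightarrow> real" where "R = (\<lambda>i. 1 - 1 / real (Suc i))"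
  have R: "0 \<le> R i" "R i < 1" for i
    by (auto simp: R_def)
  have limR: "R \<longlonglongrightarrow> 1"
    unfolding R_def using tendsto_diff[OF tendsto_const LIMSEQ_inverse_real_of_nat, of 1]
    by (simp add: divide_inverse)
  \<comment> \<open>Monotone convergence: the cut-off weights increase with the radius, and at each
    point the sequence is eventually constant.\<close>
  have lim: "(\<lambda>i. \<integral>\<^sup>+z. F z * g (R i) z \<partial>lborel) \<longlonglongrightarrow> (\<integral>\<^sup>+z. F z * g 1 z \<partial>lborel)"
    if [measurable]: "F \<in> borel_measurable borel" for F
  proof (rule nn_integral_LIMSEQ)
    have "R i \<le> R j" if "i \<le> j" for i j
      using that by (simp add: R_def frac_le)
    then show "incseq (\<lambda>i z. F z * g (R i) z)"
      by (fastforce simp: incseq_def le_fun_def g_def intro!: mult_left_mono split: split_indicator)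
    show "(\<lambda>i. F z * g (R i) z) \<longlonglongrightarrow> F z * g 1 z" for z
    proof (cases "cmod z < 1")
      case True
      from order_tendstoD(1)[OF limR this]
      have "\<forall>\<^sub>F i in sequentially. F z * g (R i) z = F z * g 1 z"
        by eventually_elim (use True in \<open>simp add: g_def\<close>)
      then show ?thesis
        by (rule tendsto_eventually)
    next
      case False
      then have "g (R i) z = g 1 z" for i
        using R(2)[of i] by (simp add: g_def)
      then show ?thesis by simp
    qed
  qed measurable
  have "(\<integral>\<^sup>+z. ennreal ((cmod (S z))\<^sup>2) * g 1 z \<partial>lborel) = (\<integral>\<^sup>+z. G z * g 1 z \<partial>lborel)"
    using lim[of "\<lambda>z. ennreal ((cmod (S z))\<^sup>2)"] lim[of G] eq[OF R]
    by (auto intro: LIMSEQ_unique)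
  moreover have "(\<integral>\<^sup>+z\<in>ball 0 1. ennreal ((cmod (f z))\<^sup>2 * h (cmod z)) \<partial>lborel) =
      (\<integral>\<^sup>+z. ennreal ((cmod (S z))\<^sup>2) * g 1 z \<partial>lborel)"
    by (intro nn_integral_cong) (auto simp: g_def S h ennreal_mult split: split_indicator)
  moreover have "(\<integral>\<^sup>+z. G z * g 1 z \<partial>lborel) =
      (\<integral>\<^sup>+z. (\<Sum>j. ennreal ((cmod (c j))\<^sup>2) * (ennreal (cmod z ^ (2 * j) * h (cmod z)) * indicator (ball 0 1) z)) \<partial>lborel)"
    unfolding G_def ennreal_suminf_multc[symmetric]
    by (intro nn_integral_cong suminf_cong) (auto simp: g_def h ennreal_mult mult_ac split: split_indicator)
  moreover have "\<dots> = (\<Sum>j. ennreal ((cmod (c j))\<^sup>2) *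
      (\<integral>\<^sup>+z\<in>ball 0 1. ennreal (cmod z ^ (2 * j) * h (cmod z)) \<partial>lborel))"
    by (subst nn_integral_suminf) (auto simp: nn_integral_cmult)
  ultimately show ?thesis
    by simp
qed

subsection \<open>Convex kernels on the circle\<close>

lemma summable_inverse_square: "summable (\<lambda>m. 1 / (real m)\<^sup>2)"
  using inverse_power_summable[of 2, where 'a = real] by (simp add: divide_inverse)

lemma convex_on_LIMSEQ:
  fixes F :: "nat \<Rightarrow> 'a::real_vector \<Rightarrow> real"
  assumes conv: "\<And>i. convex_on S (F i)" and lim: "\<And>x. x \<in> S \<Longrightarrow> (\<lambda>i. F i x) \<longlonglongrightarrow> G x"
  shows "convex_on S G"
proof (rule convex_onI)
  show S: "convex S"
    using conv convex_on_imp_convex by blast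
  fix t :: real and x y
  assume t: "0 < t" "t < 1" and xy: "x \<in> S" "y \<in> S"
  have z: "(1 - t) *\<^sub>R x + t *\<^sub>R y \<in> S"
    using S t xy by (simp add: convex_alt)
  show "G ((1 - t) *\<^sub>R x + t *\<^sub>R y) \<le> (1 - t) * G x + t * G y"
  proof (rule LIMSEQ_le[OF lim[OF z]])
    show "(\<lambda>i. (1 - t) * F i x + t * F i y) \<longlonglongrightarrow> (1 - t) * G x + t * G y"
      by (intro tendsto_intros lim xy)
    show "\<exists>N. \<forall>n\<ge>N. F n ((1 - t) *\<^sub>R x + t *\<^sub>R y) \<le> (1 - t) * F n x + t * F n y"
      using convex_onD[OF conv] t xy by (meson less_imp_le)
  qed
qed

text \<open>Real part of the geometric series in \<open>r * cis t\<close>; it gives the second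
  derivative of the Abel means in closed form.\<close>

lemma sums_power_cos:
  fixes r t :: real
  assumes "0 \<le> r" "r < 1"
  shows "(\<lambda>m. r ^ m * cos (real m * t)) sums ((1 - r * cos t) / (1 - 2 * r * cos t + r\<^sup>2))"
proof -
  have "cmod (of_real r * cis t) < 1"
    using assms by (simp add: norm_mult)
  from sums_Re[OF geometric_sums[OF this]]
  have "(\<lambda>m. r ^ m * cos (real m * t)) sums Re (1 / (1 - of_real r * cis t))"
    by (simp add: power_mult_distrib Complex.DeMoivre flip: of_real_power)
  also have "Re (1 / (1 - of_real r * cis t)) = (1 - r * cos t) / ((1 - r * cos t)\<^sup>2 + (r * sin t)\<^sup>2)"
    by (simp add: Re_divide)
  also have "(1 - r * cos t)\<^sup>2 + (r * sin t)\<^sup>2 = 1 - 2 * r * cos t + r\<^sup>2 * ((sin t)\<^sup>2 + (cos t)\<^sup>2)"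
    by algebra
  finally show ?thesis
    by simp
qed

text \<open>The series is \<open>t\<^sup>2 / 4 - pi * t / 2 + pi\<^sup>2 / 6\<close>, but only this convexity matters.  For the Abel
  means \<open>r < 1\<close> the second derivative of the series is \<open>1 / 2\<close> minus half the Poisson kernel, which
  tends to \<open>0\<close> uniformly away from the end points.\<close>

lemma convex_on_cos_series:
  "convex_on {0<..<2 * pi} (\<lambda>t. (\<Sum>m. cos (real m * t) / (real m)\<^sup>2) - t\<^sup>2 / 4)"
proof -
  define F where "F = (\<lambda>r t. \<Sum>m. r ^ m * cos (real m * t) / (real m)\<^sup>2)"
  \<comment> \<open>The last quadratic has second derivative
    \<open>(1 - r^2) / (2 * (sin d)^2)\<close>. On this interval it outweighs the Poisson term, and
    it disappears as \<open>r\<close> tends to \<open>1\<close>.\<close>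
  have conv: "convex_on {d..2 * pi - d} (\<lambda>t. F r t - t\<^sup>2 / 4 + (1 - r\<^sup>2) / (2 * (sin d)\<^sup>2) * (t\<^sup>2 / 2))"
    if r: "0 \<le> r" "r < 1" and d: "0 < d" "d < pi" for r d
  proof -
    define F1 where "F1 = (\<lambda>t. \<Sum>m. - (r ^ m * sin (real m * t) / real m))"
    \<comment> \<open>The term \<open>m = 0\<close> of \<open>F\<close> is \<open>0\<close>, since
      division by \<open>0\<close> gives \<open>0\<close>; the constant term of the cosine series is
      therefore removed.\<close>
    define F2 where "F2 = (\<lambda>t. \<Sum>m. - (if m = 0 then 0 else r ^ m * cos (real m * t)))"
    have sr: "summable (\<lambda>m. r ^ m)"
      using r by simp
    have F1: "(F r has_real_derivative F1 t) (at t)" for t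
      unfolding F_def F1_def
    proof (rule has_field_derivative_series'(2)[where S = UNIV and ?x0.0 = t])
      show "((\<lambda>t. r ^ m * cos (real m * t) / (real m)\<^sup>2) has_real_derivative
          - (r ^ m * sin (real m * t) / real m)) (at t within UNIV)" for m t
        by (cases "m = 0") (auto intro!: derivative_eq_intros simp: power2_eq_square)
      show "uniformly_convergent_on UNIV (\<lambda>n t. \<Sum>m<n. - (r ^ m * sin (real m * t) / real m))"
      proof (rule Weierstrass_m_test'[OF _ sr])
        fix m and t :: real
        have "\<bar>sin (real m * t)\<bar> / real m \<le> 1"
          by (cases "m = 0") (auto simp: divide_le_eq intro: order_trans[OF abs_sin_le_one])
        then show "norm (- (r ^ m * sin (real m * t) / real m)) \<le> r ^ m"
          using r mult_left_le[of "\<bar>sin (real m * t)\<bar> / real m" "r ^ m"]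
          by (simp add: abs_mult abs_divide)
      qed
      show "summable (\<lambda>m. r ^ m * cos (real m * t) / (real m)\<^sup>2)"
      proof (rule summable_comparison_test'[OF summable_inverse_square, of 0])
        fix m :: nat
        have "r ^ m * \<bar>cos (real m * t)\<bar> \<le> 1"
          using r by (intro mult_le_one) (auto simp: power_le_one)
        then show "norm (r ^ m * cos (real m * t) / (real m)\<^sup>2) \<le> 1 / (real m)\<^sup>2"
          using r by (simp add: abs_mult divide_right_mono)
      qed
    qed auto
    have F2: "(F1 has_real_derivative F2 t) (at t)" for t
      unfolding F1_def F2_def
    proof (rule has_field_derivative_series'(2)[where S = UNIV and ?x0.0 = 0])
      show "((\<lambda>t. - (r ^ m * sin (real m * t) / real m)) has_real_derivative
          - (if m = 0 then 0 else r ^ m * cos (real m * t))) (at t within UNIV)" for m t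
        by (cases "m = 0") (auto intro!: derivative_eq_intros)
      show "uniformly_convergent_on UNIV (\<lambda>n t. \<Sum>m<n. - (if m = 0 then 0 else r ^ m * cos (real m * t)))"
      proof (rule Weierstrass_m_test'[OF _ sr])
        fix m and t :: real
        show "norm (- (if m = 0 then 0 else r ^ m * cos (real m * t))) \<le> r ^ m"
          using r by (simp add: abs_mult mult_left_le)
      qed
    qed auto
    have F2_eq: "F2 t = 1 / 2 - (1 - r\<^sup>2) / (2 * (1 - 2 * r * cos t + r\<^sup>2))" for t
    proof -
      have "1 - 2 * r * cos t + r\<^sup>2 \<ge> 1 - 2 * r + r\<^sup>2"
        using r by (simp add: mult_left_le)
      moreover have "1 - 2 * r + r\<^sup>2 = (1 - r)\<^sup>2"
        by (simp add: power2_eq_square algebra_simps)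
      ultimately have pos: "1 - 2 * r * cos t + r\<^sup>2 > 0"
        using r by (smt (verit) zero_less_power)
      have "(\<lambda>m. - (if m = 0 then 0 else r ^ m * cos (real m * t))) sums
          (1 - (1 - r * cos t) / (1 - 2 * r * cos t + r\<^sup>2))"
        using sums_diff[OF sums_single[of 0 "\<lambda>_. 1"] sums_power_cos[OF r, of t]]
        by (rule sums_cong[THEN iffD1, rotated]) auto
      then have "F2 t = 1 - (1 - r * cos t) / (1 - 2 * r * cos t + r\<^sup>2)"
        by (simp add: F2_def sums_iff)
      also have "\<dots> = 1 / 2 - (1 - r\<^sup>2) / (2 * (1 - 2 * r * cos t + r\<^sup>2))"
        using pos by (simp add: field_simps)
      finally show ?thesis .
    qed
    define e where "e = (1 - r\<^sup>2) / (2 * (sin d)\<^sup>2)"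
    have "convex_on {d..2 * pi - d} (\<lambda>t. F r t - t\<^sup>2 / 4 + e * (t\<^sup>2 / 2))"
    proof (rule f''_ge0_imp_convex)
      show "((\<lambda>t. F r t - t\<^sup>2 / 4 + e * (t\<^sup>2 / 2)) has_real_derivative F1 t - t / 2 + e * t) (at t)" for t
        by (auto intro!: derivative_eq_intros F1)
      show "((\<lambda>t. F1 t - t / 2 + e * t) has_real_derivative F2 t - 1 / 2 + e) (at t)" for t
        by (auto intro!: derivative_eq_intros F2)
      fix t assume t: "t \<in> {d..2 * pi - d}"
      have "cos t \<le> cos d"
      proof (cases "t \<le> pi")
        case True
        then show ?thesis using t d by (intro cos_monotone_0_pi_le) auto
      next
        case False
        then have "cos (2 * pi - t) \<le> cos d" using t d by (intro cos_monotone_0_pi_le) auto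
        then show ?thesis by simp
      qed
      then have "r * cos t \<le> r * cos d"
        using r by (intro mult_left_mono) auto
      \<comment> \<open>Completing the square in \<open>r\<close> bounds the Poisson denominator
        from below by \<open>(sin d)^2\<close>, uniformly in \<open>t\<close> and
        \<open>r\<close>.\<close>
      moreover have "1 - 2 * r * cos d + r\<^sup>2 = (sin d)\<^sup>2 + (r - cos d)\<^sup>2"
        using sin_cos_squared_add[of d] unfolding power2_diff by linarith
      ultimately have "(sin d)\<^sup>2 \<le> 1 - 2 * r * cos t + r\<^sup>2"
        using zero_le_power2[of "r - cos d"] by linarith
      moreover have "0 < (sin d)\<^sup>2"
        using sin_gt_zero[OF d] by simp
      moreover have "0 \<le> 1 - r\<^sup>2"
        using r by (simp add: power_le_one)
      ultimately have "(1 - r\<^sup>2) / (2 * (1 - 2 * r * cos t + r\<^sup>2)) \<le> (1 - r\<^sup>2) / (2 * (sin d)\<^sup>2)"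
        by (intro frac_le) auto
      then show "0 \<le> F2 t - 1 / 2 + e"
        by (simp add: F2_eq e_def)
    qed simp
    then show ?thesis
      by (simp only: e_def)
  qed
  define R :: "nat \<Rightarrow> real" where "R = (\<lambda>i. 1 - 1 / real (Suc i))"
  have R: "0 \<le> R i" "R i < 1" for i
    by (auto simp: R_def)
  have limR: "R \<longlonglongrightarrow> 1"
    unfolding R_def using tendsto_diff[OF tendsto_const LIMSEQ_inverse_real_of_nat, of 1]
    by (simp add: divide_inverse)
  have limF: "(\<lambda>i. F (R i) t) \<longlonglongrightarrow> F 1 t" for t
    unfolding F_def
  proof (rule tannerys_theorem[THEN conjunct2, THEN conjunct2, OF _ _ summable_inverse_square])
    show "(\<lambda>i. R i ^ m * cos (real m * t) / (real m)\<^sup>2) \<longlonglongrightarrow> 1 ^ m * cos (real m * t) / (real m)\<^sup>2" for m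
      by (cases "m = 0") (simp, intro tendsto_intros limR, simp)
    show "\<forall>\<^sub>F (m, i) in at_top \<times>\<^sub>F sequentially.
        norm (R i ^ m * cos (real m * t) / (real m)\<^sup>2) \<le> 1 / (real m)\<^sup>2"
    proof (rule always_eventually, clarify)
      fix m i
      have "R i ^ m * \<bar>cos (real m * t)\<bar> \<le> 1"
        using R[of i] by (intro mult_le_one) (auto simp: power_le_one)
      then show "norm (R i ^ m * cos (real m * t) / (real m)\<^sup>2) \<le> 1 / (real m)\<^sup>2"
        using R[of i] by (simp add: abs_mult divide_right_mono)
    qed
  qed simp
  have conv1: "convex_on {d..2 * pi - d} (\<lambda>t. F 1 t - t\<^sup>2 / 4)" if d: "0 < d" "d < pi" for d
  proof (rule convex_on_LIMSEQ[OF conv[OF R d]])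
    fix t
    have "(\<lambda>i. F (R i) t - t\<^sup>2 / 4 + (1 - (R i)\<^sup>2) / (2 * (sin d)\<^sup>2) * (t\<^sup>2 / 2)) \<longlonglongrightarrow>
        F 1 t - t\<^sup>2 / 4 + (1 - 1\<^sup>2) / (2 * (sin d)\<^sup>2) * (t\<^sup>2 / 2)"
      using sin_gt_zero[OF d] by (intro tendsto_intros limF limR) auto
    then show "(\<lambda>i. F (R i) t - t\<^sup>2 / 4 + (1 - (R i)\<^sup>2) / (2 * (sin d)\<^sup>2) * (t\<^sup>2 / 2)) \<longlonglongrightarrow> F 1 t - t\<^sup>2 / 4"
      by simp
  qed
  have "convex_on {0<..<2 * pi} (\<lambda>t. F 1 t - t\<^sup>2 / 4)"
  proof (rule convex_onI)
    fix s x y :: real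
    assume s: "0 < s" "s < 1" and xy: "x \<in> {0<..<2 * pi}" "y \<in> {0<..<2 * pi}"
    \<comment> \<open>Small enough for \<open>{d..2 * pi - d}\<close> to contain both points; the
      entry \<open>pi / 2\<close> keeps \<open>d < pi\<close> when both points are
      \<open>pi\<close>.\<close>
    define d where "d = Min {x, y, 2 * pi - x, 2 * pi - y, pi / 2}"
    have d: "0 < d" "d < pi"
      using xy pi_gt_zero by (auto simp: d_def min_def)
    have "x \<in> {d..2 * pi - d}" "y \<in> {d..2 * pi - d}"
      by (auto simp: d_def min_def)
    then show "F 1 ((1 - s) *\<^sub>R x + s *\<^sub>R y) - ((1 - s) *\<^sub>R x + s *\<^sub>R y)\<^sup>2 / 4 \<le>
        (1 - s) * (F 1 x - x\<^sup>2 / 4) + s * (F 1 y - y\<^sup>2 / 4)"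
      using convex_onD[OF conv1[OF d], of s x y] s by simp
  qed simp
  then show ?thesis
    by (simp add: F_def)
qed

section \<open>Fejer sums and the kernels \<open>min_kernel\<close>\<close>

text \<open>The right-hand side is twice the second derivative that occurs in
  \<open>convex_on_min_kernel\<close>; the left-hand side shows that it is nonnegative.\<close>

lemma fejer_identity:
  fixes t :: real
  shows "(cmod (\<Sum>j<s. cis (real j * t)))\<^sup>2 = real s + 2 * (\<Sum>m\<in>{1..<s}. (real s - real m) * cos (real m * t))"
proof (induction s)
  case (Suc s)
  define T where "T = (\<Sum>j<s. cis (real j * t))"
  have add_sq: "(cmod (a + b))\<^sup>2 = (cmod a)\<^sup>2 + (cmod b)\<^sup>2 + 2 * Re (b * cnj a)" for a b
    by (simp only: cmod_power2) (simp add: power2_eq_square algebra_simps)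
  have "(cmod (T + cis (real s * t)))\<^sup>2 = (cmod T)\<^sup>2 + 1 + 2 * Re (cis (real s * t) * cnj T)"
    using add_sq[of T "cis (real s * t)"] by simp
  also have "Re (cis (real s * t) * cnj T) = (\<Sum>j<s. cos (real (s - j) * t))"
    by (simp add: T_def sum_distrib_left cis_cnj cis_mult of_nat_diff left_diff_distrib)
  also have "\<dots> = (\<Sum>m\<in>{1..<Suc s}. cos (real m * t))"
    by (rule sum.reindex_bij_witness[where i = "\<lambda>m. s - m" and j = "\<lambda>j. s - j"]) auto
  also have "(cmod T)\<^sup>2 = real s + 2 * (\<Sum>m\<in>{1..<s}. (real s - real m) * cos (real m * t))"
    unfolding T_def by (rule Suc)
  \<comment> \<open>The added term \<open>m = s\<close> has coefficient \<open>0\<close>, so both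
    sums now run over the same range.\<close>
  also have "(\<Sum>m\<in>{1..<s}. (real s - real m) * cos (real m * t)) =
      (\<Sum>m\<in>{1..<Suc s}. (real s - real m) * cos (real m * t))"
    by (intro sum.mono_neutral_left) (auto simp: less_Suc_eq)
  finally show ?case
    by (simp add: T_def algebra_simps sum.distrib sum_distrib_left sum_subtractf del: sum.op_ivl_Suc)
qed simp

text \<open>The coefficient of the \<open>m\<close>-th cosine is \<open>1 / m\<close> for
  \<open>0 < m \<le> s\<close> and \<open>s / m^2\<close> beyond. The functions
  \<open>min m s\<close> are the pieces from which \<open>concave_energy_ge\<close> builds every
  admissible weight.\<close>

definition min_kernel :: "nat \<Rightarrow> real \<Rightarrow> real" where
  "min_kernel s t = (\<Sum>m. real (min m s) / (real m)\<^sup>2 * cos (real m * t))"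

lemma summable_inverse_square_mult:
  fixes b :: "nat \<Rightarrow> real"
  assumes "\<And>m. \<bar>b m\<bar> \<le> B"
  shows "summable (\<lambda>m. b m / (real m)\<^sup>2)"
proof (rule summable_comparison_test'[of "\<lambda>m. B * (1 / (real m)\<^sup>2)" 0])
  show "norm (b m / (real m)\<^sup>2) \<le> B * (1 / (real m)\<^sup>2)" for m
    using assms[of m] by (simp add: divide_right_mono)
qed (intro summable_mult summable_inverse_square)

lemma summable_min_kernel:
  "summable (\<lambda>m. real (min m s) / (real m)\<^sup>2 * cos (real m * t))"
proof -
  have "summable (\<lambda>m. (real (min m s) * cos (real m * t)) / (real m)\<^sup>2)"
  proof (rule summable_inverse_square_mult)
    show "\<bar>real (min m s) * cos (real m * t)\<bar> \<le> real s * 1" for m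
      unfolding abs_mult by (intro mult_mono) auto
  qed
  then show ?thesis by simp
qed

text \<open>For \<open>m < s\<close>, \<open>min m s\<close> is \<open>s\<close> minus
  \<open>s - m\<close>, so the kernel is \<open>s\<close> times the full cosine series minus a
  finite sum \<open>C\<close>. Moving \<open>s * t^2 / 4\<close> from the first part to the second
  makes both convex: the first by \<open>convex_on_cos_series\<close>, the second because its second
  derivative is half a Fejer sum.\<close>

lemma convex_on_min_kernel: "convex_on {0<..<2 * pi} (min_kernel s)"
proof -
  define B where "B = (\<lambda>t. \<Sum>m. cos (real m * t) / (real m)\<^sup>2)"
  define C where "C = (\<lambda>t. \<Sum>m\<in>{1..<s}. (real s - real m) / (real m)\<^sup>2 * cos (real m * t))"
  have eq: "min_kernel s t = real s * (B t - t\<^sup>2 / 4) + (real s * t\<^sup>2 / 4 - C t)" for t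
  proof -
    have "summable (\<lambda>m. cos (real m * t) / (real m)\<^sup>2)"
      by (rule summable_inverse_square_mult[of _ 1]) auto
    then have "(\<lambda>m. real s * (cos (real m * t) / (real m)\<^sup>2)) sums (real s * B t)"
      unfolding B_def by (intro sums_mult summable_sums)
    moreover have "(\<lambda>m. if m \<in> {1..<s} then (real s - real m) / (real m)\<^sup>2 * cos (real m * t) else 0) sums C t"
      unfolding C_def by (rule sums_If_finite_set) auto
    ultimately have "(\<lambda>m. real s * (cos (real m * t) / (real m)\<^sup>2) -
        (if m \<in> {1..<s} then (real s - real m) / (real m)\<^sup>2 * cos (real m * t) else 0)) sums (real s * B t - C t)"
      by (rule sums_diff)
    moreover have "real s * (cos (real m * t) / (real m)\<^sup>2) -
        (if m \<in> {1..<s} then (real s - real m) / (real m)\<^sup>2 * cos (real m * t) else 0) =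
        real (min m s) / (real m)\<^sup>2 * cos (real m * t)" for m
      by (cases "m = 0") (auto simp: min_def diff_divide_distrib left_diff_distrib)
    ultimately have "min_kernel s t = real s * B t - C t"
      by (simp add: min_kernel_def sums_iff)
    then show ?thesis
      by (simp add: algebra_simps)
  qed
  have "convex_on {0<..<2 * pi} (\<lambda>t. real s * t\<^sup>2 / 4 - C t)"
  proof (rule f''_ge0_imp_convex)
    show "((\<lambda>t. real s * t\<^sup>2 / 4 - C t) has_real_derivative
        real s * t / 2 - (\<Sum>m\<in>{1..<s}. - ((real s - real m) / real m * sin (real m * t)))) (at t)" for t
      unfolding C_def by (auto intro!: derivative_eq_intros sum.cong simp: power2_eq_square mult_ac)
    show "((\<lambda>t. real s * t / 2 - (\<Sum>m\<in>{1..<s}. - ((real s - real m) / real m * sin (real m * t))))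
        has_real_derivative
        real s / 2 - (\<Sum>m\<in>{1..<s}. - ((real s - real m) * cos (real m * t)))) (at t)" for t
      by (auto intro!: derivative_eq_intros sum.cong)
    show "0 \<le> real s / 2 - (\<Sum>m\<in>{1..<s}. - ((real s - real m) * cos (real m * t)))" for t
      using fejer_identity[of t s] zero_le_power2[of "cmod (\<Sum>j<s. cis (real j * t))"]
      by (simp add: sum_negf)
  qed simp
  moreover have "convex_on {0<..<2 * pi} (\<lambda>t. real s * (B t - t\<^sup>2 / 4))"
    using convex_on_cos_series unfolding B_def by (intro convex_on_cmul) auto
  ultimately have "convex_on {0<..<2 * pi} (\<lambda>t. real s * (B t - t\<^sup>2 / 4) + (real s * t\<^sup>2 / 4 - C t))"
    by (intro convex_on_add)
  then show ?thesis
    by (simp add: eq[abs_def])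
qed

lemma min_kernel_periodic: "min_kernel s (t + 2 * pi) = min_kernel s t"
proof -
  have "cos (real m * (t + 2 * pi)) = cos (real m * t)" for m
    using cos.plus_of_nat[of "real m * t" m] by (simp add: algebra_simps)
  then show ?thesis
    by (simp add: min_kernel_def)
qed

section \<open>Jensen's inequality for cyclic gaps\<close>

lemma sum_periodic_shift:
  fixes g :: "nat \<Rightarrow> 'a::ab_group_add"
  assumes "\<And>l. g (l + n) = g l"
  shows "(\<Sum>j<n. g (k + j)) = (\<Sum>l<n. g l)"
proof (induction k)
  case (Suc k)
  have "(\<Sum>j<n. g (Suc k + j)) - (\<Sum>j<n. g (k + j)) = g (k + n) - g k"
    using sum_lessThan_telescope[of "\<lambda>j. g (k + j)" n] by (simp add: sum_subtractf)
  then show ?case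
    using Suc assms[of k] by simp
qed simp

text \<open>The ordered pairs are grouped by the number \<open>j\<close> of places between their
  members, counted cyclically. The \<open>n\<close> gaps of one group add up to
  \<open>2 * pi * j\<close>, so by Jensen their energy is at least that of \<open>n\<close> equal
  gaps \<open>2 * pi * j / n\<close>, which are the gaps of equidistributed points.\<close>

lemma sum_convex_differences_ge:
  fixes K :: "real \<Rightarrow> real" and \<theta> :: "nat \<Rightarrow> real"
  assumes conv: "convex_on {0<..<2 * pi} K" and per: "\<And>t. K (t + 2 * pi) = K t"
    and mono: "strict_mono \<theta>" and quasi: "\<And>k. \<theta> (k + n) = \<theta> k + 2 * pi" and n: "n > 0"
  shows "(\<Sum>k<n. \<Sum>l<n. K (2 * pi * real l / real n - 2 * pi * real k / real n)) \<le>
    (\<Sum>k<n. \<Sum>l<n. K (\<theta> l - \<theta> k))"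
proof -
  have swap: "(\<Sum>k<n. \<Sum>l<n. K (e l - e k)) = (\<Sum>j<n. \<Sum>k<n. K (e (k + j) - e k))"
    if q: "\<And>k. e (k + n) = e k + 2 * pi" for e :: "nat \<Rightarrow> real"
  proof -
    have "(\<Sum>l<n. K (e l - e k)) = (\<Sum>j<n. K (e (k + j) - e k))" for k
    proof (rule sum_periodic_shift[symmetric])
      show "K (e (l + n) - e k) = K (e l - e k)" for l
        using per[of "e l - e k"] by (simp add: q algebra_simps)
    qed
    then show ?thesis
      by (simp only:) (rule sum.swap)
  qed
  define e where "e = (\<lambda>k. 2 * pi * real k / real n)"
  have e: "e (k + n) = e k + 2 * pi" "e (k + j) - e k = e j" for k j
    using n by (simp_all add: e_def field_simps)
  \<comment> \<open>Passing from \<open>j\<close> to \<open>Suc j\<close> adds the \<open>n\<close>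
    consecutive gaps of one full turn.\<close>
  have total: "(\<Sum>k<n. \<theta> (k + j) - \<theta> k) = 2 * pi * real j" for j
  proof (induction j)
    case (Suc j)
    have "(\<Sum>k<n. \<theta> (k + Suc j) - \<theta> k) - (\<Sum>k<n. \<theta> (k + j) - \<theta> k) =
        (\<Sum>k<n. \<theta> (Suc k + j) - \<theta> (k + j))"
      by (simp flip: sum_subtractf)
    also have "\<dots> = \<theta> (n + j) - \<theta> (0 + j)"
      by (rule sum_lessThan_telescope)
    also have "\<dots> = 2 * pi"
      using quasi[of j] by (simp add: add.commute)
    finally show ?case
      using Suc by (simp add: algebra_simps)
  qed simp
  have "(\<Sum>k<n. K (e (k + j) - e k)) \<le> (\<Sum>k<n. K (\<theta> (k + j) - \<theta> k))" if "j < n" for j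
  \<comment> \<open>For \<open>j = 0\<close> both sides are \<open>n\<close> times
    \<open>K 0\<close>. For other \<open>j < n\<close> all gaps lie in the open interval on which
    \<open>K\<close> is convex.\<close>
  proof (cases "j = 0")
    case False
    have range: "\<theta> (k + j) - \<theta> k \<in> {0<..<2 * pi}" for k
      using strict_monoD[OF mono, of k "k + j"] strict_monoD[OF mono, of "k + j" "k + n"]
        quasi[of k] False \<open>j < n\<close> by auto
    have "K (\<Sum>k<n. (1 / real n) *\<^sub>R (\<theta> (k + j) - \<theta> k)) \<le> (\<Sum>k<n. 1 / real n * K (\<theta> (k + j) - \<theta> k))"
      using n range by (intro convex_on_sum[OF _ _ conv]) auto
    moreover have "(\<Sum>k<n. (1 / real n) *\<^sub>R (\<theta> (k + j) - \<theta> k)) = e j"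
      unfolding scaleR_sum_right[symmetric] total by (simp add: e_def)
    ultimately have "real n * K (e j) \<le> (\<Sum>k<n. K (\<theta> (k + j) - \<theta> k))"
      using n by (simp add: field_simps flip: sum_divide_distrib)
    then show ?thesis
      by (simp add: e)
  qed simp
  then have "(\<Sum>k<n. \<Sum>l<n. K (e l - e k)) \<le> (\<Sum>k<n. \<Sum>l<n. K (\<theta> l - \<theta> k))"
    unfolding swap[of e, OF e(1)] swap[of \<theta>, OF quasi] by (rule sum_mono) simp
  then show ?thesis
    by (simp add: e_def)
qed

lemma cmod_sum_cis_square:
  "(cmod (\<Sum>k\<in>A. cis (\<theta> k)))\<^sup>2 = (\<Sum>k\<in>A. \<Sum>l\<in>A. cos (\<theta> l - \<theta> k))"
  unfolding cmod_power2
  by (simp add: Re_sum Im_sum power2_eq_square sum_product cos_diff sum.distrib mult.commute)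

text \<open>The squared modulus of a power sum is a double sum of cosines of \<open>m\<close> times
  the angle differences; summing over \<open>m\<close> first turns each pair into a value of the
  kernel.\<close>

lemma min_energy_eq:
  "(\<Sum>m. real (min m s) / (real m)\<^sup>2 * (cmod (\<Sum>k<n. cis (\<theta> k) ^ m))\<^sup>2) =
    (\<Sum>k<n. \<Sum>l<n. min_kernel s (\<theta> l - \<theta> k))"
proof -
  have "(\<lambda>m. \<Sum>k<n. \<Sum>l<n. real (min m s) / (real m)\<^sup>2 * cos (real m * (\<theta> l - \<theta> k))) sums
      (\<Sum>k<n. \<Sum>l<n. min_kernel s (\<theta> l - \<theta> k))"
    unfolding min_kernel_def by (intro sums_sum summable_sums summable_min_kernel)
  moreover have "(cmod (\<Sum>k<n. cis (\<theta> k) ^ m))\<^sup>2 = (\<Sum>k<n. \<Sum>l<n. cos (real m * (\<theta> l - \<theta> k)))" for m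
    by (simp add: Complex.DeMoivre cmod_sum_cis_square right_diff_distrib)
  ultimately show ?thesis
    by (simp add: sums_iff sum_distrib_left)
qed

text \<open>The arguments in \<open>[0, 2 pi)\<close> are listed in increasing order and continued
  by \<open>2 pi\<close> per turn, as \<open>sum_convex_differences_ge\<close> requires. Sorting
  permutes the points, so only their set is preserved.\<close>

lemma sorted_angles:
  fixes a :: "nat \<Rightarrow> complex"
  assumes a: "\<And>k. k < n \<Longrightarrow> cmod (a k) = 1" and inj: "inj_on a {..<n}" and n: "n > 0"
  obtains \<theta> :: "nat \<Rightarrow> real" where "strict_mono \<theta>" "\<And>k. \<theta> (k + n) = \<theta> k + 2 * pi"
    "bij_betw (\<lambda>k. cis (\<theta> k)) {..<n} (a ` {..<n})"
proof -
  define L where "L = sorted_list_of_set ((\<lambda>k. Arg2pi (a k)) ` {..<n})"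
  have cis: "cis (Arg2pi (a k)) = a k" if "k < n" for k
    using Arg2pi_eq[of "a k"] a[OF that] by (simp add: cis_conv_exp mult.commute)
  have inj': "inj_on (\<lambda>k. Arg2pi (a k)) {..<n}"
    using inj cis by (metis (no_types, lifting) inj_on_def lessThan_iff)
  have len: "length L = n"
    by (simp add: L_def card_image[OF inj'])
  have set: "set L = (\<lambda>k. Arg2pi (a k)) ` {..<n}"
    by (simp add: L_def)
  have sorted: "L ! i < L ! j" if "i < j" "j < n" for i j
    using strict_sorted_list_of_set[of "(\<lambda>k. Arg2pi (a k)) ` {..<n}"] that len
    by (simp add: L_def sorted_wrt_iff_nth_less)
  have L: "0 \<le> L ! i" "L ! i < 2 * pi" if "i < n" for i
    using that set nth_mem[of i L] len Arg2pi_ge_0 Arg2pi_lt_2pi by auto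
  define \<theta> where "\<theta> = (\<lambda>k. L ! (k mod n) + 2 * pi * real (k div n))"
  show ?thesis
  proof
    show "\<theta> (k + n) = \<theta> k + 2 * pi" for k
      using n by (simp add: \<theta>_def algebra_simps)
    show "strict_mono \<theta>"
    proof (rule strict_monoI_Suc)
      fix k
      show "\<theta> k < \<theta> (Suc k)"
      \<comment> \<open>At the end of a turn the next angle is the smallest argument plus
        \<open>2 pi\<close>, which exceeds every argument in \<open>[0, 2 pi)\<close>.\<close>
      proof (cases "Suc (k mod n) = n")
        case True
        then show ?thesis
          using L[of 0] L[of "k mod n"] n by (simp add: \<theta>_def mod_Suc div_Suc algebra_simps)
      next
        case False
        then have "Suc (k mod n) < n"
          using n by (simp add: Suc_lessI)
        then show ?thesis
          using sorted[of "k mod n" "Suc (k mod n)"] False by (simp add: \<theta>_def mod_Suc div_Suc)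
      qed
    qed
    have bL: "bij_betw ((!) L) {..<n} ((\<lambda>k. Arg2pi (a k)) ` {..<n})"
      by (rule bij_betw_nth) (simp_all add: len set, simp add: L_def)
    have "inj_on cis ((\<lambda>k. Arg2pi (a k)) ` {..<n})"
      using cis by (auto simp: inj_on_def)
    moreover have "cis ` ((\<lambda>k. Arg2pi (a k)) ` {..<n}) = a ` {..<n}"
      using cis by (auto simp: image_image)
    ultimately have "bij_betw (cis \<circ> (!) L) {..<n} (a ` {..<n})"
      by (intro bij_betw_trans[OF bL]) (simp add: bij_betw_def)
    then show "bij_betw (\<lambda>k. cis (\<theta> k)) {..<n} (a ` {..<n})"
      by (rule bij_betw_cong[THEN iffD1, rotated]) (simp add: \<theta>_def)
  qed
qed

text \<open>Power sums do not depend on the order of the points, so the sorted angles may be used,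
  and the gap inequality applies to \<open>min_kernel s\<close>.\<close>

lemma min_energy_ge:
  fixes a :: "nat \<Rightarrow> complex"
  assumes a: "\<And>k. k < n \<Longrightarrow> cmod (a k) = 1" and inj: "inj_on a {..<n}"
  shows "(\<Sum>m. real (min m s) / (real m)\<^sup>2 * (cmod (\<Sum>k<n. cis (2 * pi * real k / real n) ^ m))\<^sup>2) \<le>
    (\<Sum>m. real (min m s) / (real m)\<^sup>2 * (cmod (\<Sum>k<n. a k ^ m))\<^sup>2)"
proof (cases "n = 0")
  case False
  then obtain \<theta> :: "nat \<Rightarrow> real" where \<theta>: "strict_mono \<theta>" "\<And>k. \<theta> (k + n) = \<theta> k + 2 * pi"
      "bij_betw (\<lambda>k. cis (\<theta> k)) {..<n} (a ` {..<n})"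
    using sorted_angles[OF a inj] by auto
  have "(\<Sum>k<n. a k ^ m) = (\<Sum>k<n. cis (\<theta> k) ^ m)" for m
    using sum.reindex_bij_betw[OF \<theta>(3), of "\<lambda>z. z ^ m"] sum.reindex[OF inj, of "\<lambda>z. z ^ m"]
    by simp
  then show ?thesis
    using sum_convex_differences_ge[OF convex_on_min_kernel min_kernel_periodic \<theta>(1,2), of s] False
    by (simp only: min_energy_eq)
qed simp

subsection \<open>Concave weights\<close>

lemma power_sum_square_le:
  fixes a :: "nat \<Rightarrow> complex"
  assumes "\<And>k. k < n \<Longrightarrow> cmod (a k) = 1"
  shows "(cmod (\<Sum>k<n. a k ^ m))\<^sup>2 \<le> (real n)\<^sup>2"
proof -
  have "cmod (\<Sum>k<n. a k ^ m) \<le> (\<Sum>k<n. 1)"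
    using assms by (intro order_trans[OF norm_sum] sum_mono) (simp add: norm_power)
  then show ?thesis
    by (simp add: power_mono)
qed

text \<open>Summation by parts writes \<open>w\<close> as a superposition of the functions
  \<open>min m (Suc s)\<close>, with the negated second differences as coefficients. These are
  nonnegative by concavity, so the inequality for each \<open>min\<close> function adds up and
  passes to the limit.\<close>

lemma concave_energy_ge:
  fixes a :: "nat \<Rightarrow> complex" and w :: "nat \<Rightarrow> real"
  assumes a: "\<And>k. k < n \<Longrightarrow> cmod (a k) = 1" and inj: "inj_on a {..<n}"
    and w0: "w 0 = 0" and mono: "\<And>m. w m \<le> w (Suc m)" and bound: "\<And>m. w m \<le> B"
    and concave: "\<And>m. w m + w (Suc (Suc m)) \<le> 2 * w (Suc m)"
  shows "(\<Sum>m. w m / (real m)\<^sup>2 * (cmod (\<Sum>k<n. cis (2 * pi * real k / real n) ^ m))\<^sup>2) \<le>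
    (\<Sum>m. w m / (real m)\<^sup>2 * (cmod (\<Sum>k<n. a k ^ m))\<^sup>2)"
proof -
  define d where "d = (\<lambda>s. w (Suc s) - w s)"
  \<comment> \<open>The truncated superposition; it falls short of \<open>w (min m S)\<close> by the
    linear remainder \<open>min m S * d S\<close>.\<close>
  define V where "V = (\<lambda>S m. \<Sum>s<S. (d s - d (Suc s)) * real (min m (Suc s)))"
  have d: "0 \<le> d s" "d (Suc s) \<le> d s" for s
    using mono[of s] concave[of s] by (simp_all add: d_def)
  have V: "V S m = w (min m S) - real (min m S) * d S" for S m
  proof (induction S)
    case (Suc S)
    then have "V (Suc S) m = w (min m S) - real (min m S) * d S + (d S - d (Suc S)) * real (min m (Suc S))"
      by (simp add: V_def)
    also have "\<dots> = w (min m (Suc S)) - real (min m (Suc S)) * d (Suc S)"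
      by (cases "m \<le> S") (auto simp: min_def d_def algebra_simps le_Suc_eq)
    finally show ?case .
  qed (simp add: V_def w0)
  have V_nonneg: "0 \<le> V S m" for S m
    unfolding V_def using d by (intro sum_nonneg mult_nonneg_nonneg) auto
  have V_le: "V S m \<le> B" for S m
    using d(1)[of S] bound[of "min m S"] mult_nonneg_nonneg[of "real (min m S)" "d S"]
    unfolding V by linarith
  have "incseq w"
    using mono by (rule incseq_SucI)
  then obtain L where L: "w \<longlonglongrightarrow> L"
    using incseq_convergent[of w B] bound by blast
  \<comment> \<open>A bounded increasing sequence converges, so its increments vanish; this removes
    the linear remainder for fixed \<open>m\<close>.\<close>
  have "d \<longlonglongrightarrow> 0"
    unfolding d_def using tendsto_diff[OF LIMSEQ_Suc[OF L] L] by simp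
  have V_lim: "(\<lambda>S. V S m) \<longlonglongrightarrow> w m" for m
  proof -
    have "(\<lambda>S. w m - real m * d S) \<longlonglongrightarrow> w m - real m * 0"
      by (intro tendsto_intros \<open>d \<longlonglongrightarrow> 0\<close>)
    then have "(\<lambda>S. w m - real m * d S) \<longlonglongrightarrow> w m" by simp
    moreover have "\<forall>\<^sub>F S in sequentially. w m - real m * d S = V S m"
      using eventually_ge_at_top[of m] by eventually_elim (simp add: V min_absorb1)
    ultimately show ?thesis
      by (rule Lim_transform_eventually)
  qed
  have lim: "(\<lambda>S. \<Sum>s<S. (d s - d (Suc s)) * (\<Sum>m. real (min m (Suc s)) / (real m)\<^sup>2 * (cmod (\<Sum>k<n. x k ^ m))\<^sup>2))
      \<longlonglongrightarrow> (\<Sum>m. w m / (real m)\<^sup>2 * (cmod (\<Sum>k<n. x k ^ m))\<^sup>2)"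
    if x: "\<And>k. k < n \<Longrightarrow> cmod (x k) = 1" for x :: "nat \<Rightarrow> complex"
  proof -
    define P where "P = (\<lambda>m. (cmod (\<Sum>k<n. x k ^ m))\<^sup>2)"
    have P: "0 \<le> P m" "P m \<le> (real n)\<^sup>2" for m
      unfolding P_def by (simp, rule power_sum_square_le[OF x])
    have summ: "summable (\<lambda>m. real (min m s) / (real m)\<^sup>2 * P m)" for s
    proof -
      have "summable (\<lambda>m. (real (min m s) * P m) / (real m)\<^sup>2)"
      proof (rule summable_inverse_square_mult)
        show "\<bar>real (min m s) * P m\<bar> \<le> real s * (real n)\<^sup>2" for m
          using P unfolding abs_mult by (intro mult_mono) auto
      qed
      then show ?thesis by simp
    qed
    have "(\<lambda>m. \<Sum>s<S. (d s - d (Suc s)) * (real (min m (Suc s)) / (real m)\<^sup>2 * P m)) sums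
        (\<Sum>s<S. (d s - d (Suc s)) * (\<Sum>m. real (min m (Suc s)) / (real m)\<^sup>2 * P m))" for S
      by (intro sums_sum sums_mult summable_sums summ)
    moreover have "(\<Sum>s<S. (d s - d (Suc s)) * (real (min m (Suc s)) / (real m)\<^sup>2 * P m)) =
        V S m / (real m)\<^sup>2 * P m" for S m
      by (simp add: V_def sum_distrib_right sum_divide_distrib mult.assoc)
    ultimately have eq: "(\<Sum>s<S. (d s - d (Suc s)) * (\<Sum>m. real (min m (Suc s)) / (real m)\<^sup>2 * P m)) =
        (\<Sum>m. V S m / (real m)\<^sup>2 * P m)" for S
      by (simp add: sums_iff)
    \<comment> \<open>Tannery's theorem: \<open>0 \<le> V S m \<le> B\<close> and
      \<open>P m \<le> n^2\<close> give a majorant independent of \<open>S\<close>.\<close>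
    have "(\<lambda>S. \<Sum>m. V S m / (real m)\<^sup>2 * P m) \<longlonglongrightarrow> (\<Sum>m. w m / (real m)\<^sup>2 * P m)"
    proof (rule tannerys_theorem[THEN conjunct2, THEN conjunct2])
      show "(\<lambda>S. V S m / (real m)\<^sup>2 * P m) \<longlonglongrightarrow> w m / (real m)\<^sup>2 * P m" for m
        by (cases "m = 0") (simp, intro tendsto_intros V_lim, simp)
      show "\<forall>\<^sub>F (m, S) in at_top \<times>\<^sub>F sequentially.
          norm (V S m / (real m)\<^sup>2 * P m) \<le> B * (real n)\<^sup>2 * (1 / (real m)\<^sup>2)"
      proof (rule always_eventually, clarify)
        fix m S
        have "V S m * P m \<le> B * (real n)\<^sup>2"
          using P V_nonneg[of S m] V_le[of S m] by (intro mult_mono) auto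
        then show "norm (V S m / (real m)\<^sup>2 * P m) \<le> B * (real n)\<^sup>2 * (1 / (real m)\<^sup>2)"
          using P(1)[of m] V_nonneg[of S m] by (simp add: abs_mult divide_right_mono)
      qed
      show "summable (\<lambda>m. B * (real n)\<^sup>2 * (1 / (real m)\<^sup>2))"
        by (intro summable_mult summable_inverse_square)
    qed simp
    then show ?thesis
      unfolding eq[symmetric] by (simp add: P_def)
  qed
  show ?thesis
  proof (rule LIMSEQ_le[OF lim lim])
    show "\<exists>S0. \<forall>S\<ge>S0.
        (\<Sum>s<S. (d s - d (Suc s)) * (\<Sum>m. real (min m (Suc s)) / (real m)\<^sup>2 *
          (cmod (\<Sum>k<n. cis (2 * pi * real k / real n) ^ m))\<^sup>2)) \<le>
        (\<Sum>s<S. (d s - d (Suc s)) * (\<Sum>m. real (min m (Suc s)) / (real m)\<^sup>2 * (cmod (\<Sum>k<n. a k ^ m))\<^sup>2))"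
      using d by (intro exI allI impI sum_mono mult_left_mono min_energy_ge a inj) auto
  qed (use a in auto)
qed

section \<open>The weights coming from the Bergman norm\<close>

text \<open>Divided by \<open>m^2\<close> and up to a constant factor, this is the squared binomial
  coefficient of \<open>z ^ (m - N)\<close> times the Beta integral of that monomial. It has this
  meaning for \<open>N \<le> m\<close>, where the subtraction does not truncate.\<close>

definition bergman_weight :: "nat \<Rightarrow> nat \<Rightarrow> real" where
  "bergman_weight N m = (fact m)\<^sup>2 / (fact (m - N) * fact (m + N))"

lemma bergman_weight_pos: "0 < bergman_weight N m"
  by (simp add: bergman_weight_def)

text \<open>The ratio of successive weights is
  \<open>(m + 1)^2 / ((m + 1 - N) * (m + 1 + N))\<close>, whose denominator is a difference of
  squares. Monotonicity and concavity are read off from it.\<close>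

lemma bergman_weight_Suc:
  assumes "N \<le> m"
  shows "bergman_weight N (Suc m) * ((real m + 1)\<^sup>2 - (real N)\<^sup>2) = bergman_weight N m * (real m + 1)\<^sup>2"
proof -
  obtain j where m: "m = N + j"
    using assms le_Suc_ex by blast
  have "(real m + 1)\<^sup>2 - (real N)\<^sup>2 = real (Suc j) * real (Suc (m + N))"
    by (simp add: m power2_eq_square algebra_simps)
  moreover have "bergman_weight N (Suc m) =
      (real m + 1)\<^sup>2 * (fact m)\<^sup>2 / ((real (Suc j) * fact j) * (real (Suc (m + N)) * fact (m + N)))"
    by (simp add: bergman_weight_def m Suc_diff_le power_mult_distrib add.commute)
  moreover have "bergman_weight N m = (fact m)\<^sup>2 / (fact j * fact (m + N))"
    by (simp add: bergman_weight_def m)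
  moreover have "x * F / ((A * f) * (B * g)) * (A * B) = F / (f * g) * x"
    if "A \<noteq> 0" "B \<noteq> 0" for x F A B f g :: real
    using that by (simp add: divide_simps)
  ultimately show ?thesis
    by simp
qed

text \<open>Induction on \<open>N\<close>: each step replaces the factor \<open>m - N\<close> of the
  denominator by the larger factor \<open>m + N + 1\<close>.\<close>

lemma bergman_weight_le_1: "N \<le> m \<Longrightarrow> bergman_weight N m \<le> 1"
proof -
  have "(fact m)\<^sup>2 \<le> (fact (m - N) * fact (m + N) :: real)" if "N \<le> m"
    using that
  proof (induction N)
    case (Suc N)
    define j where "j = m - Suc N"
    have j: "m - N = Suc j" "Suc N \<le> m" "m - Suc N = j"
      using Suc.prems by (auto simp: j_def)
    have "(fact m)\<^sup>2 \<le> (fact (m - N) * fact (m + N) :: real)"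
      using Suc by simp
    also have "\<dots> = real (Suc j) * (fact j * fact (m + N))"
      unfolding j by (simp add: algebra_simps)
    also have "\<dots> \<le> real (Suc (m + N)) * (fact j * fact (m + N))"
      by (intro mult_right_mono) (auto simp: j_def)
    also have "\<dots> = fact (m - Suc N) * fact (m + Suc N)"
      unfolding j by (simp add: algebra_simps)
    finally show ?case .
  qed (simp add: power2_eq_square)
  then show "N \<le> m \<Longrightarrow> bergman_weight N m \<le> 1"
    by (simp add: bergman_weight_def)
qed

text \<open>Below \<open>M = N\<^sup>2 - 1\<close> the power sums vanish, so the weight may be changed there. The linear
  extension through the origin is concave exactly from this \<open>M\<close> on: it needs
  \<open>bergman_weight N (M + 1) / (M + 1) \<le> bergman_weight N M / M\<close>, which is \<open>N\<^sup>2 \<le> M + 1\<close>.\<close>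

definition concave_weight :: "nat \<Rightarrow> nat \<Rightarrow> real" where
  "concave_weight N m =
     (if m < N\<^sup>2 - 1 then real m * bergman_weight N (N\<^sup>2 - 1) / real (N\<^sup>2 - 1) else bergman_weight N m)"

context
  fixes N M :: nat
  assumes N: "N > 1" and M_def: "M = N\<^sup>2 - 1"
begin

lemma N_less_M: "N < M"
proof -
  have "2 * N \<le> N\<^sup>2"
    using N by (simp add: power2_eq_square)
  then show ?thesis
    unfolding M_def using N by linarith
qed

lemma concave_weight_0: "concave_weight N 0 = 0"
  using N_less_M by (simp add: concave_weight_def M_def)

lemma bergman_weight_mono:
  assumes "N \<le> m"
  shows "bergman_weight N m \<le> bergman_weight N (Suc m)"
proof -
  have "real N * real N < (real m + 1) * (real m + 1)"
    using assms by (intro mult_strict_mono) auto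
  then have "bergman_weight N (Suc m) * ((real m + 1)\<^sup>2 - (real N)\<^sup>2) \<le> bergman_weight N (Suc m) * (real m + 1)\<^sup>2"
      "0 < (real m + 1)\<^sup>2"
    using bergman_weight_pos[of N "Suc m"] by (auto simp: power2_eq_square)
  then show ?thesis
    unfolding bergman_weight_Suc[OF assms] by simp
qed

lemma concave_weight_linear:
  "m \<le> M \<Longrightarrow> concave_weight N m = real m * (bergman_weight N (M) / real (M))"
  using N_less_M unfolding concave_weight_def M_def[symmetric] by auto

lemma concave_weight_eq: "M \<le> m \<Longrightarrow> concave_weight N m = bergman_weight N m"
  by (simp add: concave_weight_def M_def)

lemma concave_weight_mono: "concave_weight N m \<le> concave_weight N (Suc m)"
proof (cases "Suc m \<le> M")
  case True
  then show ?thesis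
    using bergman_weight_pos[of N "M"] by (simp add: concave_weight_linear mult_right_mono divide_right_mono)
next
  case False
  then show ?thesis
    using bergman_weight_mono[of m] N_less_M by (simp add: concave_weight_eq)
qed

lemma concave_weight_le_1: "concave_weight N m \<le> 1"
proof -
  have "concave_weight N m \<le> concave_weight N (max m (M))"
    using lift_Suc_mono_le[of "concave_weight N", OF concave_weight_mono] by simp
  also have "\<dots> \<le> 1"
    using N_less_M by (simp add: concave_weight_eq bergman_weight_le_1)
  finally show ?thesis .
qed

text \<open>The increments before and after \<open>Suc m\<close> are compared. They agree in the
  linear range and also at the junction \<open>M\<close>; beyond it the ratio formula shows that
  they do not increase.\<close>

lemma concave_weight_concave:
  "concave_weight N m + concave_weight N (Suc (Suc m)) \<le> 2 * concave_weight N (Suc m)"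
proof -
  have M: "N < M" "(real N)\<^sup>2 = real M + 1"
    using N_less_M N by (auto simp: M_def of_nat_diff)
  consider "Suc (Suc m) \<le> M" | "Suc m = M" | "M \<le> m" by linarith
  then show ?thesis
  proof cases
    case 1
    define c where "c = bergman_weight N M / real M"
    have "concave_weight N k = real k * c" if "k \<le> M" for k
      using concave_weight_linear[OF that] by (simp add: c_def)
    then show ?thesis
      using 1 by (simp add: algebra_simps)
  next
    case 2
    define u where "u = bergman_weight N M"
    \<comment> \<open>Since \<open>N^2 = M + 1\<close>, the ratio at the junction is
      \<open>(M + 1) / M\<close>, so the value at \<open>Suc M\<close> still lies on the line
      through the origin.\<close>
    have "(real M + 1)\<^sup>2 - (real N)\<^sup>2 = (real M + 1) * real M"
      unfolding M(2) by (simp add: power2_eq_square algebra_simps)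
    then have "bergman_weight N (Suc M) * ((real M + 1) * real M) = u * (real M + 1)\<^sup>2"
      using bergman_weight_Suc[of N M] M(1) by (simp only: u_def less_imp_le)
    then have "(bergman_weight N (Suc M) * real M) * (real M + 1) = (u * (real M + 1)) * (real M + 1)"
      by (simp only: power2_eq_square mult_ac)
    then have "bergman_weight N (Suc M) * real M = u * (real M + 1)"
      unfolding mult_cancel_right by simp
    then have "bergman_weight N (Suc M) = u + u / real M"
      using M(1) by (simp add: field_simps)
    moreover have "concave_weight N m = u - u / real M"
      using 2 concave_weight_linear[of m] by (auto simp: u_def field_simps)
    moreover have "concave_weight N (Suc m) = u" "concave_weight N (Suc (Suc m)) = bergman_weight N (Suc M)"
      using 2 by (simp_all add: concave_weight_eq u_def)
    ultimately show ?thesis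
      by simp
  next
    case 3
    define u where "u = bergman_weight N (Suc m)"
    define x where "x = real m + 1"
    have u: "0 < u"
      by (simp add: u_def bergman_weight_pos)
    have x: "(real N)\<^sup>2 \<le> x" "1 < x" "real N < x"
      using 3 M by (auto simp: x_def)
    have xN: "(real N)\<^sup>2 < x\<^sup>2"
      using x by (simp add: power_strict_mono)
    have "bergman_weight N m = u * (x\<^sup>2 - (real N)\<^sup>2) / x\<^sup>2"
      using bergman_weight_Suc[of N m] 3 M x by (simp add: u_def x_def field_simps)
    also have "\<dots> = u - u * (real N)\<^sup>2 / x\<^sup>2"
      using x by (simp add: field_simps)
    finally have 1: "bergman_weight N m = u - u * (real N)\<^sup>2 / x\<^sup>2" .
    \<comment> \<open>The two increments are \<open>u * N^2\<close> divided by \<open>x^2\<close>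
      and by \<open>(x + 1)^2 - N^2\<close>; the second denominator is the larger because
      \<open>N^2 \<le> x\<close>.\<close>
    have le: "x\<^sup>2 \<le> (x + 1)\<^sup>2 - (real N)\<^sup>2"
      using x by (simp add: power2_eq_square algebra_simps)
    have pos: "0 < (x + 1)\<^sup>2 - (real N)\<^sup>2"
      using le x by (smt (verit) zero_less_power)
    have "bergman_weight N (Suc (Suc m)) = u * (x + 1)\<^sup>2 / ((x + 1)\<^sup>2 - (real N)\<^sup>2)"
      using bergman_weight_Suc[of N "Suc m"] 3 M pos by (simp add: u_def x_def field_simps)
    also have "\<dots> = u + u * (real N)\<^sup>2 / ((x + 1)\<^sup>2 - (real N)\<^sup>2)"
      using pos by (simp add: field_simps)
    finally have 2: "bergman_weight N (Suc (Suc m)) = u + u * (real N)\<^sup>2 / ((x + 1)\<^sup>2 - (real N)\<^sup>2)" .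
    have "u * (real N)\<^sup>2 / ((x + 1)\<^sup>2 - (real N)\<^sup>2) \<le> u * (real N)\<^sup>2 / x\<^sup>2"
      using le x u by (intro frac_le) auto
    then have "bergman_weight N m + bergman_weight N (Suc (Suc m)) \<le> 2 * bergman_weight N (Suc m)"
      unfolding 1 2 u_def[symmetric] by simp
    then show ?thesis
      using 3 by (simp add: concave_weight_eq)
  qed
qed

end

subsection \<open>Sums of poles\<close>

lemma nn_integral_beta_nat:
  "(\<integral>\<^sup>+t\<in>{0..<1}. ennreal (t ^ j * (1 - t) ^ k) \<partial>lborel) = ennreal (fact j * fact k / fact (j + k + 1))"
proof -
  have "((\<lambda>t. t powr (real (Suc j) - 1) * (1 - t) powr (real (Suc k) - 1)) has_integral
      Beta (real (Suc j)) (real (Suc k))) {0<..<1}"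
    using has_integral_Beta_real[of "real (Suc j)" "real (Suc k)"]
    by (simp add: has_integral_Icc_iff_Ioo)
  also have "?this \<longleftrightarrow> ((\<lambda>t. t ^ j * (1 - t) ^ k) has_integral Beta (real (Suc j)) (real (Suc k))) {0<..<1}"
    by (rule has_integral_cong) (auto simp: powr_realpow)
  finally have int: "((\<lambda>t. t ^ j * (1 - t) ^ k) has_integral Beta (real (Suc j)) (real (Suc k))) {0<..<1}" .
  have "(\<integral>\<^sup>+t\<in>{0..<1}. ennreal (t ^ j * (1 - t) ^ k) \<partial>lborel) =
      (\<integral>\<^sup>+t\<in>{0<..<1}. ennreal (t ^ j * (1 - t) ^ k) \<partial>lborel)"
    by (intro nn_integral_cong_AE AE_I[of _ _ "{0}"]) (auto split: split_indicator)
  also have "\<dots> = ennreal (Beta (real (Suc j)) (real (Suc k)))"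
    by (rule nn_integral_has_integral_lebesgue'[OF _ int]) auto
  also have "Beta (real (Suc j)) (real (Suc k)) = fact j * fact k / fact (j + k + 1)"
    using Gamma_fact[of j, where 'a = real] Gamma_fact[of k, where 'a = real]
      Gamma_fact[of "j + k + 1", where 'a = real]
    by (simp add: Beta_def add_ac)
  finally show ?thesis .
qed

text \<open>Integrating in \<open>t\<close>, the squared modulus, turns the radial integral into a
  Beta integral.\<close>

lemma nn_integral_disc_monomial:
  "(\<integral>\<^sup>+z\<in>ball 0 1. ennreal (cmod z ^ (2 * j) * (1 - (cmod z)\<^sup>2) ^ k) \<partial>lborel) =
    ennreal (pi * (fact j * fact k / fact (j + k + 1)))"
  using nn_integral_radial[of "\<lambda>t. ennreal (t ^ j * (1 - t) ^ k)"]
  by (simp add: nn_integral_beta_nat power_mult del: fact_Suc flip: ennreal_mult')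

text \<open>Newton's binomial series with exponent \<open>-N\<close>; negating the upper index makes
  the coefficients natural numbers.\<close>

lemma sums_inverse_power:
  fixes w :: complex
  assumes "cmod w < 1" and "N > 0"
  shows "(\<lambda>j. of_nat ((N + j - 1) choose j) * w ^ j) sums (1 / (1 - w) ^ N)"
proof -
  have "(\<lambda>j. ((- of_nat N) gchoose j) * (- w) ^ j) sums (1 + - w) powr (- of_nat N)"
    using assms by (intro gen_binomial_complex) simp
  also have "(\<lambda>j. ((- of_nat N) gchoose j) * (- w) ^ j) = (\<lambda>j. of_nat ((N + j - 1) choose j) * w ^ j)"
  proof
    fix j
    have "((- of_nat N) gchoose j) = (-1) ^ j * (of_nat ((N + j - 1) choose j) :: complex)"
      using \<open>N > 0\<close> by (simp add: gbinomial_minus binomial_gbinomial of_nat_diff)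
    then have "((- of_nat N) gchoose j) * (- w) ^ j = ((-1) ^ j * (-1) ^ j) * (of_nat ((N + j - 1) choose j) * w ^ j)"
      by (subst power_minus) (simp only: mult_ac)
    then show "((- of_nat N) gchoose j) * (- w) ^ j = of_nat ((N + j - 1) choose j) * w ^ j"
      by (simp flip: power_mult_distrib)
  qed
  also have "(1 + - w) powr (- of_nat N) = 1 / (1 - w) ^ N"
    using assms by (simp add: powr_minus powr_nat' divide_inverse)
  finally show ?thesis .
qed

text \<open>On the unit circle \<open>1 / a = cnj a\<close>, so each pole is
  \<open>(-1) ^ N * cnj a ^ N / (1 - cnj a * z) ^ N\<close>. The coefficient of \<open>z ^ j\<close>
  therefore contains the conjugate of the power sum of order \<open>j + N\<close>.\<close>

lemma pole_sum_sums:
  assumes a: "\<And>k. k < n \<Longrightarrow> cmod (a k) = 1" and z: "cmod z < 1" and N: "N > 0"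
  shows "(\<lambda>j. (-1) ^ N * of_nat ((N + j - 1) choose j) * cnj (\<Sum>k<n. a k ^ (j + N)) * z ^ j) sums
    pole_sum N n a z"
proof -
  have "(\<lambda>j. (-1) ^ N * of_nat ((N + j - 1) choose j) * cnj (a k ^ (j + N)) * z ^ j) sums (1 / (z - a k) ^ N)"
    if "k < n" for k
  proof -
    have aa: "a k * cnj (a k) = 1"
      using a[OF that] by (simp add: complex_norm_square[symmetric])
    have "cmod (cnj (a k) * z) < 1"
      using a[OF that] z by (simp add: norm_mult)
    from sums_mult[OF sums_inverse_power[OF this N], of "(-1) ^ N * cnj (a k) ^ N"]
    have "(\<lambda>j. (-1) ^ N * of_nat ((N + j - 1) choose j) * cnj (a k ^ (j + N)) * z ^ j) sums
        ((-1) ^ N * cnj (a k) ^ N * (1 / (1 - cnj (a k) * z) ^ N))"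
      by (simp add: power_mult_distrib power_add mult_ac)
    also have "(-1) ^ N * cnj (a k) ^ N * (1 / (1 - cnj (a k) * z) ^ N) = 1 / (z - a k) ^ N"
    proof -
      have "z - a k = - (a k) * (1 - cnj (a k) * z)"
        using aa by (simp add: algebra_simps)
      moreover have "inverse (- a k) = (-1) * cnj (a k)"
        using aa by (intro inverse_unique) simp
      ultimately have "inverse (z - a k) = (-1) * cnj (a k) * inverse (1 - cnj (a k) * z)"
        by (simp only: inverse_mult_distrib)
      then have "inverse ((z - a k) ^ N) = ((-1) * cnj (a k) * inverse (1 - cnj (a k) * z)) ^ N"
        by (simp only: power_inverse[symmetric])
      then show ?thesis
        by (simp only: divide_inverse power_mult_distrib power_inverse mult_1_left mult.assoc)
    qed
    finally show ?thesis .
  qed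
  then have "(\<lambda>j. \<Sum>k<n. (-1) ^ N * of_nat ((N + j - 1) choose j) * cnj (a k ^ (j + N)) * z ^ j) sums pole_sum N n a z"
    unfolding pole_sum_def by (intro sums_sum) auto
  then show ?thesis
    by (simp add: sum_distrib_left sum_distrib_right)
qed

text \<open>One nonnegative integral, evaluated by Parseval, yields both integrability and the norm.
  The vanishing power sums allow \<open>concave_weight\<close> in place of
  \<open>bergman_weight\<close>.\<close>

lemma bergman_pole_sum:
  fixes a :: "nat \<Rightarrow> complex"
  assumes N: "N > 1" and a: "\<And>k. k < n \<Longrightarrow> cmod (a k) = 1"
    and vanish: "\<And>m. m \<in> {1..N\<^sup>2 - 2} \<Longrightarrow> (\<Sum>k<n. a k ^ m) = 0"
  shows "pole_sum N n a \<in> bergman_space (alpha_star N)"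
    and "bergman_norm (alpha_star N) (pole_sum N n a) =
      sqrt (fact (2 * N) / (fact (N - 1))\<^sup>2 * (\<Sum>m. concave_weight N m / (real m)\<^sup>2 * (cmod (\<Sum>k<n. a k ^ m))\<^sup>2))"
proof -
  define p where "p = (\<lambda>m. \<Sum>k<n. a k ^ m)"
  define c where "c = (\<lambda>j. (-1) ^ N * of_nat ((N + j - 1) choose j) * cnj (p (j + N)))"
  define T where "T = (\<lambda>m. concave_weight N m / (real m)\<^sup>2 * (cmod (p m))\<^sup>2)"
  \<comment> \<open>The factor \<open>alpha_star N + 1 = 2 * N\<close> of the norm later completes
    the numerator to \<open>fact (2 * N)\<close>.\<close>
  define C where "C = fact (2 * N - 1) / (fact (N - 1) :: real)\<^sup>2"
  have N_less: "N < N\<^sup>2 - 1"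
    by (rule N_less_M[OF N refl])
  have weight: "0 \<le> concave_weight N m" "concave_weight N m \<le> 1" for m
    using lift_Suc_mono_le[of "concave_weight N" 0 m, OF concave_weight_mono[OF N refl]]
      concave_weight_0[OF N refl] concave_weight_le_1[OF N refl] by simp_all
  have p_bound: "(cmod (p m))\<^sup>2 \<le> (real n)\<^sup>2" for m
    unfolding p_def by (rule power_sum_square_le[OF a])
  have "summable (\<lambda>m. concave_weight N m * (cmod (p m))\<^sup>2 / (real m)\<^sup>2)"
  proof (rule summable_inverse_square_mult)
    show "\<bar>concave_weight N m * (cmod (p m))\<^sup>2\<bar> \<le> 1 * (real n)\<^sup>2" for m
      using weight[of m] p_bound[of m] unfolding abs_mult by (intro mult_mono) auto
  qed
  then have "T sums suminf T"
    by (simp add: T_def summable_sums)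
  \<comment> \<open>Coefficient \<open>j\<close> belongs to the power sum of order
    \<open>j + N\<close>. The orders below \<open>N\<close> contribute \<open>0\<close>: order
    \<open>0\<close> through its weight, the others because their power sums vanish.\<close>
  moreover have "T m = 0" if "m < N" for m
    using that N_less vanish[of m] by (cases "m = 0") (auto simp: T_def p_def)
  ultimately have T_sums: "(\<lambda>j. T (j + N)) sums suminf T"
    by (subst sums_zero_iff_shift) auto
  have T_nonneg: "0 \<le> T m" for m
    using weight by (simp add: T_def)
  have coeff: "(cmod (c j))\<^sup>2 * (pi * (fact j * fact (2 * N - 1) / fact (j + (2 * N - 1) + 1))) = pi * C * T (j + N)" for j
  \<comment> \<open>A nonzero power sum has order at least \<open>N^2 - 1\<close>, where
    \<open>concave_weight\<close> is the true weight; otherwise both sides are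
    \<open>0\<close>.\<close>
  proof (cases "p (j + N) = 0")
    case False
    define m where "m = j + N"
    have "\<not> m \<in> {1..N\<^sup>2 - 2}"
      using False vanish[of m] by (auto simp: p_def m_def)
    then have "N\<^sup>2 - 1 \<le> m"
      using N by (auto simp: m_def)
    then have w: "concave_weight N m = (fact m)\<^sup>2 / (fact j * fact (j + 2 * N))"
      by (simp add: concave_weight_def bergman_weight_def m_def mult_2 add.assoc)
    have fm: "fact m = real m * fact (m - 1)"
      using N by (intro fact_reduce) (simp add: m_def)
    have bin: "real ((N + j - 1) choose j) = fact (m - 1) / (fact j * fact (N - 1))"
      using N binomial_fact[of j "N + j - 1", where 'a = real] by (simp add: m_def add.commute)
    have cm: "(cmod (c j))\<^sup>2 = (fact (m - 1) / (fact j * fact (N - 1)))\<^sup>2 * (cmod (p m))\<^sup>2"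
      unfolding c_def m_def[symmetric] bin[symmetric]
      by (simp add: norm_mult norm_power power_mult_distrib)
    have idx: "j + (2 * N - 1) + 1 = j + 2 * N" and "real m \<noteq> 0"
      using N by (auto simp: m_def)
    then show ?thesis
      unfolding cm T_def C_def m_def[symmetric] w fm idx power_mult_distrib power_divide
      by (simp add: power2_eq_square mult_ac)
  qed (simp add: c_def T_def)
  have "(\<integral>\<^sup>+z\<in>ball 0 1. ennreal ((cmod (pole_sum N n a z))\<^sup>2 * (1 - (cmod z)\<^sup>2) ^ (2 * N - 1)) \<partial>lborel) =
      (\<Sum>j. ennreal ((cmod (c j))\<^sup>2) *
        (\<integral>\<^sup>+z\<in>ball 0 1. ennreal (cmod z ^ (2 * j) * (1 - (cmod z)\<^sup>2) ^ (2 * N - 1)) \<partial>lborel))"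
  proof (rule nn_integral_power_series_radial)
    show "0 \<le> (1 - t\<^sup>2) ^ (2 * N - 1) \<and> (1 - t\<^sup>2) ^ (2 * N - 1) \<le> 1" if "0 \<le> t" "t < 1" for t :: real
      using that by (auto intro!: power_le_one zero_le_power simp: power_le_one)
    show "(\<lambda>j. c j * z ^ j) sums pole_sum N n a z" if "cmod z < 1" for z
      unfolding c_def p_def using N a that by (intro pole_sum_sums) auto
  qed measurable
  also have "\<dots> = (\<Sum>j. ennreal (pi * C * T (j + N)))"
    unfolding nn_integral_disc_monomial by (simp only: ennreal_mult'[symmetric] zero_le_power2 coeff)
  also have "\<dots> = ennreal (pi * C * suminf T)"
    using T_nonneg by (intro suminf_ennreal_eq sums_mult T_sums) (auto simp: C_def)
  also have "(\<integral>\<^sup>+z\<in>ball 0 1. ennreal ((cmod (pole_sum N n a z))\<^sup>2 * (1 - (cmod z)\<^sup>2) ^ (2 * N - 1)) \<partial>lborel) =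
      (\<integral>\<^sup>+z. ennreal (indicator (ball 0 1) z *\<^sub>R ((cmod (pole_sum N n a z))\<^sup>2 * (1 - (cmod z)\<^sup>2) powr alpha_star N)) \<partial>lborel)"
  proof (intro nn_integral_cong)
    fix z :: complex
    have "(1 - (cmod z)\<^sup>2) powr alpha_star N = (1 - (cmod z)\<^sup>2) ^ (2 * N - 1)" if "cmod z < 1"
    proof -
      have "alpha_star N = real (2 * N - 1)"
        using N by (simp add: alpha_star_def of_nat_diff)
      moreover have "0 < 1 - (cmod z)\<^sup>2"
        using that by (simp add: power_less_one_iff abs_square_less_1)
      ultimately show ?thesis
        by (simp only: powr_realpow)
    qed
    then show "ennreal ((cmod (pole_sum N n a z))\<^sup>2 * (1 - (cmod z)\<^sup>2) ^ (2 * N - 1)) * indicator (ball 0 1) z =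
        ennreal (indicator (ball 0 1) z *\<^sub>R ((cmod (pole_sum N n a z))\<^sup>2 * (1 - (cmod z)\<^sup>2) powr alpha_star N))"
      by (simp split: split_indicator)
  qed
  finally have nn: "(\<integral>\<^sup>+z. ennreal (indicator (ball 0 1) z *\<^sub>R
      ((cmod (pole_sum N n a z))\<^sup>2 * (1 - (cmod z)\<^sup>2) powr alpha_star N)) \<partial>lborel) = ennreal (pi * C * suminf T)" .
  have holo: "pole_sum N n a holomorphic_on ball 0 1"
    unfolding pole_sum_def using a by (intro holomorphic_intros) auto
  have "0 \<le> suminf T"
    by (rule sums_le[OF _ sums_zero T_sums]) (rule T_nonneg)
  then have nonneg: "0 \<le> pi * C * suminf T"
    by (simp add: C_def)
  have meas: "(\<lambda>z. indicator (ball 0 1) z *\<^sub>R ((cmod (pole_sum N n a z))\<^sup>2 * (1 - (cmod z)\<^sup>2) powr alpha_star N))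
      \<in> borel_measurable lborel"
    unfolding measurable_lborel2 using N a
    by (intro borel_measurable_continuous_on_indicator continuous_intros holomorphic_on_imp_continuous_on holo)
       (auto simp: alpha_star_def abs_square_eq_1)
  have int: "integrable lborel (\<lambda>z. indicator (ball 0 1) z *\<^sub>R ((cmod (pole_sum N n a z))\<^sup>2 * (1 - (cmod z)\<^sup>2) powr alpha_star N))"
    by (rule integrableI_nn_integral_finite[OF meas _ nn]) (auto simp: nonneg)
  then show "pole_sum N n a \<in> bergman_space (alpha_star N)"
    using holo by (simp add: bergman_space_def set_integrable_def)
  have "(LINT z:ball 0 1|lborel. (cmod (pole_sum N n a z))\<^sup>2 * (1 - (cmod z)\<^sup>2) powr alpha_star N) = pi * C * suminf T"
    unfolding set_lebesgue_integral_def
    by (subst integral_eq_nn_integral[OF meas]) (simp_all add: nn[unfolded real_scaleR_def] nonneg)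
  moreover have "alpha_star N + 1 = real (2 * N)"
    using N by (simp add: alpha_star_def)
  moreover have "fact (2 * N) = real (2 * N) * fact (2 * N - 1)"
    using N by (intro fact_reduce) auto
  ultimately show "bergman_norm (alpha_star N) (pole_sum N n a) =
      sqrt (fact (2 * N) / (fact (N - 1))\<^sup>2 * (\<Sum>m. concave_weight N m / (real m)\<^sup>2 * (cmod (\<Sum>k<n. a k ^ m))\<^sup>2))"
    by (simp add: bergman_norm_def C_def T_def p_def)
qed

text \<open>The polynomial with roots \<open>0, a 1, \<dots>, a (n - 1)\<close> has no constant term, so its values at the
  \<open>a k\<close> would sum to \<open>0\<close>; but only its value at \<open>a 0\<close> is nonzero.\<close>

lemma power_sums_not_all_zero:
  fixes a :: "nat \<Rightarrow> 'a::{field,ring_char_0}"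
  assumes n: "n > 0" and inj: "inj_on a {..<n}" and "a 0 \<noteq> 0"
  shows "\<exists>m\<in>{1..n}. (\<Sum>k<n. a k ^ m) \<noteq> 0"
proof (rule ccontr)
  assume "\<not> ?thesis"
  then have vanish: "(\<Sum>k<n. a k ^ m) = 0" if "1 \<le> m" "m \<le> n" for m
    using that by auto
  define P where "P = [:0, 1:] * (\<Prod>j\<in>{1..<n}. [:- a j, 1:])"
  have "degree P \<le> degree [:0, 1 :: 'a:] + degree (\<Prod>j\<in>{1..<n}. [:- a j, 1:])"
    unfolding P_def by (rule degree_mult_le)
  also have "degree (\<Prod>j\<in>{1..<n}. [:- a j, 1:]) \<le> (\<Sum>j\<in>{1..<n}. degree [:- a j, 1:])"
    using degree_prod_sum_le[of "{1..<n}" "\<lambda>j. [:- a j, 1:]"] by (simp add: o_def)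
  finally have deg: "degree P \<le> n"
    using n by simp
  have "(\<Sum>k<n. poly P (a k)) = (\<Sum>k<n. \<Sum>i\<le>degree P. coeff P i * a k ^ i)"
    by (simp add: poly_altdef)
  also have "\<dots> = (\<Sum>i\<le>degree P. coeff P i * (\<Sum>k<n. a k ^ i))"
    by (subst sum.swap) (simp add: sum_distrib_left)
  also have "\<dots> = 0"
  proof (intro sum.neutral ballI)
    fix i assume "i \<in> {..degree P}"
    moreover have "coeff P 0 = 0"
      by (simp add: P_def coeff_mult)
    ultimately show "coeff P i * (\<Sum>k<n. a k ^ i) = 0"
      using vanish[of i] deg by (cases "i = 0") auto
  qed
  finally have "(\<Sum>k<n. poly P (a k)) = 0" .
  moreover have "(\<Sum>k<n. poly P (a k)) = (\<Sum>k\<in>{0}. poly P (a k))"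
    using n by (intro sum.mono_neutral_right) (auto simp: P_def poly_prod)
  moreover have "a 0 \<noteq> a j" if "j \<in> {1..<n}" for j
    using inj_onD[OF inj, of 0 j] that n by auto
  then have "poly P (a 0) \<noteq> 0"
    using \<open>a 0 \<noteq> 0\<close> by (auto simp: P_def poly_prod)
  ultimately show False
    by simp
qed

text \<open>A geometric sum whose ratio is an \<open>n\<close>-th root of unity, different from
  \<open>1\<close> because \<open>n\<close> does not divide \<open>m\<close>.\<close>

lemma sum_roots_of_unity_power:
  assumes "\<not> n dvd m"
  shows "(\<Sum>k<n. cis (2 * pi * real k / real n) ^ m) = 0"
proof (cases "n = 0")
  case False
  define x where "x = cis (2 * pi * real m / real n)"
  have "x \<noteq> 1"
    using complex_root_unity_eq_1[of n m] False assms by (simp add: x_def cis_conv_exp mult_ac)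
  have "x ^ n = cis (2 * pi * real m)"
    using False by (simp add: x_def Complex.DeMoivre)
  also have "\<dots> = 1"
    by (rule cis_multiple_2pi) simp
  finally have "(\<Sum>k<n. x ^ k) = 0"
    using \<open>x \<noteq> 1\<close> by (simp add: geometric_sum)
  moreover have "cis (2 * pi * real k / real n) ^ m = x ^ k" for k
    by (simp add: x_def Complex.DeMoivre mult_ac)
  ultimately show ?thesis
    by simp
qed simp

section \<open>Admissibility and minimality of the roots of unity\<close>

theorem theorem1p4:
  fixes N n :: nat
  assumes "N > 1" and "W N n \<noteq> {}"
  shows "(\<forall>a \<in> W N n. pole_sum N n a \<in> bergman_space (alpha_star N)) \<and>
         Psi N n \<in> bergman_space (alpha_star N) \<and>
         is_minimum ((\<lambda>a. bergman_norm (alpha_star N) (pole_sum N n a)) ` W N n)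
           (bergman_norm (alpha_star N) (Psi N n))"
proof -
  define e where "e = (\<lambda>k. cis (2 * pi * real k / real n))"
  \<comment> \<open>Restricted because the members of \<open>W N n\<close> are extensional
    functions.\<close>
  define b where "b = restrict e {..<n}"
  have W: "cmod (a k) = 1" if "a \<in> W N n" "k < n" for a k
    using that by (auto simp: W_def PiE_iff)
  have W_inj: "inj_on a {..<n}" if "a \<in> W N n" for a
    using that by (simp add: W_def)
  have W_vanish: "(\<Sum>k<n. a k ^ m) = 0" if "a \<in> W N n" "m \<in> {1..N\<^sup>2 - 2}" for a m
    using that by (simp add: W_def)
  \<comment> \<open>If \<open>0 < n \<le> N^2 - 2\<close>, the first \<open>n\<close> power sums of
    any member of \<open>W N n\<close> would vanish, contradicting
    \<open>power_sums_not_all_zero\<close>. So nonemptiness makes every positive \<open>n\<close>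
    exceed all these \<open>m\<close>, and the roots of unity satisfy the moment conditions.\<close>
  have "\<not> n dvd m" if "m \<in> {1..N\<^sup>2 - 2}" "n > 0" for m
  proof
    assume "n dvd m"
    then have "n \<le> N\<^sup>2 - 2"
      using that dvd_imp_le[of n m] by auto
    obtain a where a: "a \<in> W N n"
      using assms(2) by blast
    have "a 0 \<noteq> 0"
      using W[OF a \<open>n > 0\<close>] by auto
    from power_sums_not_all_zero[OF \<open>n > 0\<close> W_inj[OF a] this] show False
      using W_vanish[OF a] \<open>n \<le> N\<^sup>2 - 2\<close> by auto
  qed
  then have e_vanish: "(\<Sum>k<n. e k ^ m) = 0" if "m \<in> {1..N\<^sup>2 - 2}" for m
    using that sum_roots_of_unity_power[of n m] unfolding e_def by (cases "n = 0") auto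
  have e_inj: "inj_on e {..<n}"
  proof (rule inj_onI)
    fix j k assume "j \<in> {..<n}" "k \<in> {..<n}" "e j = e k"
    then show "j = k"
      using complex_root_unity_eq[of n j k] by (simp add: e_def cis_conv_exp mult_ac)
  qed
  have b: "b \<in> W N n"
    using e_inj e_vanish by (auto simp: W_def b_def e_def inj_on_def)
  have Psi: "Psi N n = pole_sum N n b"
    by (auto simp: Psi_def pole_sum_def b_def e_def cis_conv_exp mult_ac intro!: sum.cong)
  have space: "pole_sum N n a \<in> bergman_space (alpha_star N)" if "a \<in> W N n" for a
    using bergman_pole_sum(1)[OF assms(1) W[OF that] W_vanish[OF that]] .
  have norm: "bergman_norm (alpha_star N) (pole_sum N n a) =
      sqrt (fact (2 * N) / (fact (N - 1))\<^sup>2 * (\<Sum>m. concave_weight N m / (real m)\<^sup>2 * (cmod (\<Sum>k<n. a k ^ m))\<^sup>2))"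
    if "a \<in> W N n" for a
    using bergman_pole_sum(2)[OF assms(1) W[OF that] W_vanish[OF that]] .
  have "bergman_norm (alpha_star N) (pole_sum N n b) \<le> bergman_norm (alpha_star N) (pole_sum N n a)"
    if a: "a \<in> W N n" for a
  proof -
    have "(\<Sum>k<n. b k ^ m) = (\<Sum>k<n. cis (2 * pi * real k / real n) ^ m)" for m
      by (simp add: b_def e_def)
    then have "(\<Sum>m. concave_weight N m / (real m)\<^sup>2 * (cmod (\<Sum>k<n. b k ^ m))\<^sup>2) \<le>
        (\<Sum>m. concave_weight N m / (real m)\<^sup>2 * (cmod (\<Sum>k<n. a k ^ m))\<^sup>2)"
      using concave_energy_ge[where w = "concave_weight N" and B = 1, OF W[OF a] W_inj[OF a]]
        concave_weight_0[OF assms(1) refl] concave_weight_mono[OF assms(1) refl]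
        concave_weight_le_1[OF assms(1) refl] concave_weight_concave[OF assms(1) refl]
      by simp
    then show ?thesis
      unfolding norm[OF a] norm[OF b] by (intro real_sqrt_le_mono mult_left_mono) auto
  qed
  then show ?thesis
    using space b unfolding Psi is_minimum_def by auto
qed

end
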